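(* At least one of the $1022$ triangulations (up to isomorphism) with exactly $10$ vertices (the minimal number) of the non-orientable closed surface $N_6$ of genus $6$ has a polyhedral realization in $\mathbb{R}^3$ with $2$-fold rotational symmetry.
   Context: $N_h$ denotes the connected sum of $h$ projective planes (the non-orientable closed surface of genus $h$). A triangulation of a closed connected surface $S$ is a finite two-dimensional simplicial complex $\Delta$ whose underlying space $|\Delta|$ is homeomorphic to $S$; triangulations are counted up to combinatorial (simplicial) isomorphism. The minimal number of vertices of a triangulation of $N_6$ is $10$, and there are exactly $1022$ triangulations of $N_6$ with $10$ vertices, from the known enumeration. Let $V$ be the vertex set of $\Delta$. Each map $\psi\colon V\to\mathbb{R}^3$ induces a simplexwise linear map $\phi_\psi\colon|\Delta|\to\mathbb{R}^3$. Since the surface is non-orientable, a polyhedral realization of $\Delta$ in $\mathbb{R}^3$ is a map $\phi_\psi$ that is locally injective (a simplexwise linear immersion). A geometric symmetry of a polyhedral realization $\phi_\psi$ is an isometry $g$ of $\mathbb{R}^3$ that maps $\phi_\psi(|\Delta|)$ to itself and is induced by an automorphism $\alpha$ of $\Delta$, i.e. $g\circ\phi_\psi=\phi_\psi\circ|\alpha|$. The realization has $2$-fold rotational symmetry if a rotation of order $2$ about a line is a geometric symmetry of it, induced by a nontrivial automorphism. *)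

theory Defs
  imports "HOL-Analysis.Analysis"
begin

section \<open>Finite simplicial complexes and their underlying spaces\<close>

text \<open>Abstract complexes, given by their nonempty simplices.\<close>

definition finite_simplicial_complex :: "'v set set \<Rightarrow> bool" where
  "finite_simplicial_complex K \<longleftrightarrow>
     finite K \<and> (\<forall>\<sigma>\<in>K. finite \<sigma> \<and> \<sigma> \<noteq> {}) \<and>
     (\<forall>\<sigma>\<in>K. \<forall>\<tau>. \<tau> \<subseteq> \<sigma> \<and> \<tau> \<noteq> {} \<longrightarrow> \<tau> \<in> K)"

definition two_dimensional :: "'v set set \<Rightarrow> bool" where
  "two_dimensional K \<longleftrightarrow> (\<forall>\<sigma>\<in>K. card \<sigma> \<le> 3) \<and> (\<exists>\<sigma>\<in>K. card \<sigma> = 3)"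

abbreviation vertices :: "'v set set \<Rightarrow> 'v set" where
  "vertices K \<equiv> \<Union>K"

text \<open>
  Points are given by their barycentric coordinates. The topology is that of the product topology
  on functions, which for a finite complex is the usual topology of the polyhedron.
\<close>

definition underlying_space :: "'v set set \<Rightarrow> ('v \<Rightarrow> real) set" where
  "underlying_space K =
     {x. (\<forall>v. 0 \<le> x v) \<and> {v. x v \<noteq> 0} \<in> K \<and> (\<Sum>v\<in>vertices K. x v) = 1}"

definition triangulation_of :: "'v set set \<Rightarrow> 'b topology \<Rightarrow> bool" where
  "triangulation_of K S \<longleftrightarrow>
     finite_simplicial_complex K \<and> two_dimensional K \<and>
     top_of_set (underlying_space K) homeomorphic_space S"

definition simplicial_automorphism :: "'v set set \<Rightarrow> ('v \<Rightarrow> 'v) \<Rightarrow> bool" where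
  "simplicial_automorphism K \<alpha> \<longleftrightarrow>
     bij_betw \<alpha> (vertices K) (vertices K) \<and> (\<lambda>\<sigma>. \<alpha> ` \<sigma>) ` K = K"

definition induced_map :: "'v set set \<Rightarrow> ('v \<Rightarrow> 'v) \<Rightarrow> ('v \<Rightarrow> real) \<Rightarrow> ('v \<Rightarrow> real)" where
  "induced_map K \<alpha> x = (\<lambda>w. \<Sum>v\<in>{v \<in> vertices K. \<alpha> v = w}. x v)"


section \<open>The surfaces \<open>N\<^sub>h\<close>\<close>

definition projective_plane :: "'a topology \<Rightarrow> bool" where
  "projective_plane P \<longleftrightarrow>
     (\<exists>q. quotient_map (top_of_set (sphere (0 :: real^3) 1)) P q \<and>
       (\<forall>x\<in>sphere 0 1. \<forall>y\<in>sphere 0 1. q x = q y \<longleftrightarrow> x = y \<or> x = - y))"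

text \<open>
  \<open>Z\<close> is (homeomorphic to) a connected sum of the surfaces \<open>X\<close> and \<open>Y\<close>: the interiors of embedded
  closed discs \<open>e\<close> in \<open>X\<close> and \<open>f\<close> in \<open>Y\<close> are removed, and the disjoint union of what is left
  (with \<open>X\<close> tagged by \<open>False\<close> and \<open>Y\<close> by \<open>True\<close>) is glued along the boundary circles. A gluing
  homeomorphism other than \<open>e z \<mapsto> f z\<close> is obtained by reparametrizing \<open>f\<close>.
\<close>

definition connected_sum :: "'a topology \<Rightarrow> 'a topology \<Rightarrow> 'b topology \<Rightarrow> bool" where
  "connected_sum X Y Z \<longleftrightarrow>
     (\<exists>e f q.
        embedding_map (top_of_set (cball (0 :: real^2) 1)) X e \<and>
        embedding_map (top_of_set (cball (0 :: real^2) 1)) Y f \<and>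
        (let D = sum_topology
                   (\<lambda>b. if b then subtopology Y (topspace Y - f ` ball 0 1)
                        else subtopology X (topspace X - e ` ball 0 1)) UNIV
         in quotient_map D Z q \<and>
            (\<forall>s\<in>topspace D. \<forall>t\<in>topspace D.
               q s = q t \<longleftrightarrow>
                 s = t \<or> (\<exists>z\<in>sphere 0 1. {s, t} = {(False, e z), (True, f z)}))))"

text \<open>
  \<open>nonorientable_surface h S\<close>: \<open>S\<close> is the connected sum of \<open>h \<ge> 1\<close> projective planes. All the
  intermediate sums live on the type \<open>'a\<close> of points, which therefore has to be large enough;
  \<open>nat \<Rightarrow> real\<close> contains copies of all closed surfaces.
\<close>

inductive nonorientable_surface :: "nat \<Rightarrow> 'a topology \<Rightarrow> bool" where
  one: "projective_plane P \<Longrightarrow> nonorientable_surface 1 P"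
| step: "nonorientable_surface h X \<Longrightarrow> projective_plane P \<Longrightarrow> connected_sum X P Z \<Longrightarrow>
         nonorientable_surface (Suc h) Z"


section \<open>Polyhedral realizations and their symmetries\<close>

definition simplexwise_linear_map ::
    "'v set set \<Rightarrow> ('v \<Rightarrow> real^3) \<Rightarrow> ('v \<Rightarrow> real) \<Rightarrow> real^3" where
  "simplexwise_linear_map K \<psi> x = (\<Sum>v\<in>vertices K. x v *\<^sub>R \<psi> v)"

definition locally_injective_on :: "'a::topological_space set \<Rightarrow> ('a \<Rightarrow> 'b) \<Rightarrow> bool" where
  "locally_injective_on S f \<longleftrightarrow>
     (\<forall>x\<in>S. \<exists>U. openin (top_of_set S) U \<and> x \<in> U \<and> inj_on f U)"

text \<open>
  For triangulated non-orientable surfaces, which have no embedding in three-space, a realization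
  is a simplexwise linear immersion.
\<close>

definition polyhedral_realization :: "'v set set \<Rightarrow> ('v \<Rightarrow> real^3) \<Rightarrow> bool" where
  "polyhedral_realization K \<psi> \<longleftrightarrow>
     locally_injective_on (underlying_space K) (simplexwise_linear_map K \<psi>)"

definition geometric_symmetry ::
    "'v set set \<Rightarrow> ('v \<Rightarrow> real^3) \<Rightarrow> ('v \<Rightarrow> 'v) \<Rightarrow> (real^3 \<Rightarrow> real^3) \<Rightarrow> bool" where
  "geometric_symmetry K \<psi> \<alpha> g \<longleftrightarrow>
     (\<forall>p q. dist (g p) (g q) = dist p q) \<and>
     g ` simplexwise_linear_map K \<psi> ` underlying_space K
       = simplexwise_linear_map K \<psi> ` underlying_space K \<and>
     simplicial_automorphism K \<alpha> \<and>
     (\<forall>x\<in>underlying_space K.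
        g (simplexwise_linear_map K \<psi> x) = simplexwise_linear_map K \<psi> (induced_map K \<alpha> x))"

definition rotation_about_line :: "(real^3) set \<Rightarrow> (real^3 \<Rightarrow> real^3) \<Rightarrow> bool" where
  "rotation_about_line L g \<longleftrightarrow>
     affine L \<and> aff_dim L = 1 \<and> (\<forall>p\<in>L. g p = p) \<and>
     (\<exists>A b. rotation_matrix A \<and> g = (\<lambda>p. A *v p + b))"

definition two_fold_rotational_symmetry :: "'v set set \<Rightarrow> ('v \<Rightarrow> real^3) \<Rightarrow> bool" where
  "two_fold_rotational_symmetry K \<psi> \<longleftrightarrow>
     (\<exists>L g \<alpha>. rotation_about_line L g \<and> g \<noteq> id \<and> g \<circ> g = id \<and>
        geometric_symmetry K \<psi> \<alpha> g \<and> (\<exists>v\<in>vertices K. \<alpha> v \<noteq> v))"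

end

theory Submission
  imports Defs
begin

text \<open>
  The witness is an explicit set of 28 triangles on the vertices \<open>0, \<dots>, 9\<close>, invariant under the
  involution exchanging \<open>2 i\<close> and \<open>2 i + 1\<close>, with integer coordinates on which this involution acts
  as the half-turn about the third axis; both were found by a computer search. That the map is an
  immersion is a finite condition on signs of determinants: for every vertex, the cones
  spanned by the triangles of its star meet only in common faces.

  To identify the surface, it is built up from the six-vertex projective plane by bistellar flips,
  which do not change the homeomorphism type, and by replacing a triangle with the six-vertex
  projective plane minus a triangle, which is a connected sum with a projective plane. A sequence of
  such moves with five connected sums that ends in the given triangles was again found by computer,
  and checking it is a finite computation.

  The six-vertex projective plane is the quotient by the antipodal map of the cuboctahedron whose
  square faces are cut into two triangles each, in the pattern of the icosahedron.
\<close>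

section \<open>Bistellar flips\<close>

text \<open>Euler characteristic and non-orientability would single out N_6 only through the
  classification of surfaces, whereas \<open>nonorientable_surface\<close> asks for iterated
  connected sums outright; hence the explicit construction. Flips are what makes ten vertices
  reachable: each connected sum brings in three new vertices, and five of them on top of the initial
  six would leave twenty-one. Flips at a vertex of degree three delete it; the other flips prepare
  such vertices and steer towards the symmetric target.

  The cuboctahedron takes the place of the icosahedron because its vertices are integral:
  barycentric coordinates on the cones over its triangles are then piecewise linear with simple
  rational coefficients, and evaluating them is linear arithmetic.

  Local injectivity is required at every point, but the open stars of the vertices cover the
  surface, so the stars suffice; inside a star, distances from the apex can be ignored and only
  cones of directions are compared.\<close>

abbreviation supp :: "('v \<Rightarrow> real) \<Rightarrow> 'v set" where
  "supp x \<equiv> {v. x v \<noteq> 0}"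

lemma sum_eq_sum_supp:
  assumes "finite W" "supp x \<subseteq> W"
  shows "sum x W = sum x (supp x)"
  by (rule sum.mono_neutral_right) (use assms in auto)

lemma underlying_space_iff:
  assumes "finite_simplicial_complex K"
  shows "x \<in> underlying_space K \<longleftrightarrow>
    (\<forall>v. 0 \<le> x v) \<and> supp x \<in> K \<and> sum x (supp x) = 1"
proof -
  have "finite (vertices K)" using assms by (auto simp: finite_simplicial_complex_def)
  then have "sum x (vertices K) = sum x (supp x)" if "supp x \<in> K"
    using that by (intro sum_eq_sum_supp) auto
  then show ?thesis by (auto simp: underlying_space_def)
qed

lemma underlying_spaceI:
  assumes "finite_simplicial_complex K" "\<And>v. 0 \<le> x v" "supp x \<in> K" "finite W" "supp x \<subseteq> W"
    "sum x W = 1"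
  shows "x \<in> underlying_space K"
  using assms by (simp add: underlying_space_iff sum_eq_sum_supp)

text \<open>Meant for a simplex \<open>A\<close> whose link is the boundary of \<open>B\<close>: the
  join of \<open>A\<close> with the boundary of \<open>B\<close> is exchanged for the join of the
  boundary of \<open>A\<close> with \<open>B\<close>. With two vertices in each, this switches the
  diagonal of a quadrilateral; with one in \<open>A\<close> and three in \<open>B\<close>, it
  deletes a vertex of degree three.\<close>

definition bistellar :: "'v set \<Rightarrow> 'v set \<Rightarrow> 'v set set \<Rightarrow> 'v set set" where
  "bistellar A B K = {\<sigma>\<in>K. \<not> A \<subseteq> \<sigma>} \<union> {\<sigma>. \<sigma> \<noteq> {} \<and> \<sigma> \<subseteq> A \<union> B \<and> \<not> A \<subseteq> \<sigma>}"

definition flippable :: "'v set \<Rightarrow> 'v set \<Rightarrow> 'v set set \<Rightarrow> bool" where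
  "flippable A B K \<longleftrightarrow>
     finite A \<and> finite B \<and> A \<noteq> {} \<and> B \<noteq> {} \<and> A \<inter> B = {} \<and>
     (\<forall>\<sigma>\<in>K. A \<subseteq> \<sigma> \<longrightarrow> \<sigma> \<subseteq> A \<union> B) \<and> B \<notin> K \<and>
     (\<forall>\<sigma>. \<sigma> \<noteq> {} \<and> \<sigma> \<subseteq> A \<union> B \<and> \<not> B \<subseteq> \<sigma> \<longrightarrow> \<sigma> \<in> K)"

lemma finite_simplicial_complex_bistellar:
  assumes K: "finite_simplicial_complex K" and "flippable A B K"
  shows "finite_simplicial_complex (bistellar A B K)"
proof -
  have fin: "finite (A \<union> B)" using assms by (auto simp: flippable_def)
  then have "finite {\<sigma>. \<sigma> \<noteq> {} \<and> \<sigma> \<subseteq> A \<union> B \<and> \<not> A \<subseteq> \<sigma>}"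
    by (intro finite_subset[OF _ finite_Pow_iff[THEN iffD2, OF fin]]) auto
  then have "finite (bistellar A B K)"
    using K by (simp add: finite_simplicial_complex_def bistellar_def)
  moreover have "finite \<sigma> \<and> \<sigma> \<noteq> {}" if "\<sigma> \<in> bistellar A B K" for \<sigma>
    using that K finite_subset[OF _ fin] by (auto simp: finite_simplicial_complex_def bistellar_def)
  moreover have "\<tau> \<in> bistellar A B K" if "\<sigma> \<in> bistellar A B K" "\<tau> \<subseteq> \<sigma>" "\<tau> \<noteq> {}" for \<sigma> \<tau>
  proof -
    have "\<not> A \<subseteq> \<tau>" using that unfolding bistellar_def by blast
    moreover have "\<tau> \<in> K \<or> \<tau> \<subseteq> A \<union> B"
      using that K unfolding finite_simplicial_complex_def bistellar_def by auto
    ultimately show ?thesis using that(3) by (auto simp: bistellar_def)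
  qed
  ultimately show ?thesis unfolding finite_simplicial_complex_def[of "bistellar A B K"] by blast
qed

lemma not_supset_if_flippable:
  assumes "finite_simplicial_complex K" "flippable A B K" "\<sigma> \<in> K"
  shows "\<not> B \<subseteq> \<sigma>"
  using assms unfolding finite_simplicial_complex_def flippable_def by metis

text \<open>The inverse of a flip is again a flip, with \<open>A\<close> and \<open>B\<close>
  exchanged. All facts about the inverse homeomorphism are thus instances of those about
  \<open>flip_map\<close>.\<close>

lemma flippable_bistellar:
  assumes "finite_simplicial_complex K" "flippable A B K"
  shows "flippable B A (bistellar A B K)"
proof -
  have "\<sigma> \<subseteq> B \<union> A" if "\<sigma> \<in> bistellar A B K" "B \<subseteq> \<sigma>" for \<sigma>
    using that not_supset_if_flippable[OF assms] by (auto simp: bistellar_def)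
  moreover have "A \<notin> bistellar A B K" by (simp add: bistellar_def)
  moreover have "\<sigma> \<in> bistellar A B K" if "\<sigma> \<noteq> {} \<and> \<sigma> \<subseteq> B \<union> A \<and> \<not> A \<subseteq> \<sigma>" for \<sigma>
    using that by (auto simp: bistellar_def)
  moreover have "finite A" "finite B" "A \<noteq> {}" "B \<noteq> {}" "B \<inter> A = {}"
    using assms(2) by (auto simp: flippable_def)
  ultimately show ?thesis unfolding flippable_def[of B A] by blast
qed

lemma bistellar_bistellar:
  assumes "finite_simplicial_complex K" "flippable A B K"
  shows "bistellar B A (bistellar A B K) = K"
proof -
  have ne: "\<sigma> \<in> K \<Longrightarrow> \<sigma> \<noteq> {}" for \<sigma> using assms(1) by (auto simp: finite_simplicial_complex_def)
  have sub: "\<sigma> \<in> K \<Longrightarrow> A \<subseteq> \<sigma> \<Longrightarrow> \<sigma> \<subseteq> B \<union> A" for \<sigma>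
    using assms(2) by (metis flippable_def Un_commute)
  have mem: "\<sigma> \<noteq> {} \<Longrightarrow> \<sigma> \<subseteq> B \<union> A \<Longrightarrow> \<not> B \<subseteq> \<sigma> \<Longrightarrow> \<sigma> \<in> K" for \<sigma>
    using assms(2) by (metis flippable_def Un_commute)
  show ?thesis
  proof (intro set_eqI iffI)
    fix \<sigma> assume "\<sigma> \<in> bistellar B A (bistellar A B K)"
    then show "\<sigma> \<in> K" unfolding bistellar_def using mem by (auto simp: Un_commute)
  next
    fix \<sigma> assume "\<sigma> \<in> K"
    then show "\<sigma> \<in> bistellar B A (bistellar A B K)"
      using ne sub not_supset_if_flippable[OF assms] unfolding bistellar_def by (cases "A \<subseteq> \<sigma>") simp_all
  qed
qed

text \<open>
  Moves a point parallel to the line through the barycentres of \<open>A\<close> and \<open>B\<close> until one of its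
  coordinates on \<open>A\<close> vanishes.
\<close>

definition flip_map :: "'v set \<Rightarrow> 'v set \<Rightarrow> ('v \<Rightarrow> real) \<Rightarrow> 'v \<Rightarrow> real" where
  "flip_map A B x = (\<lambda>v. x v + Min (x ` A) *
     (if v \<in> B then card A / card B else if v \<in> A then -1 else 0))"

lemma continuous_on_Min_image:
  fixes f :: "'i \<Rightarrow> 'a::topological_space \<Rightarrow> real"
  assumes "finite A" "A \<noteq> {}" "\<And>i. i \<in> A \<Longrightarrow> continuous_on S (f i)"
  shows "continuous_on S (\<lambda>x. Min ((\<lambda>i. f i x) ` A))"
  using assms by (induction A rule: finite_ne_induct) (auto intro: continuous_on_min)

lemma continuous_on_flip_map:
  assumes "flippable A B K"
  shows "continuous_on S (flip_map A B)"
proof -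
  have "continuous_on S (\<lambda>x :: 'a \<Rightarrow> real. x v)" for v
    by (rule continuous_on_subset[OF continuous_on_product_coordinates]) simp
  then show ?thesis using assms unfolding flippable_def flip_map_def
    by (intro continuous_on_coordinatewise_then_product continuous_intros continuous_on_Min_image) auto
qed

lemma flip_map_in:
  assumes K: "finite_simplicial_complex K" and fl: "flippable A B K"
    and x: "x \<in> underlying_space K"
  shows "flip_map A B x \<in> underlying_space (bistellar A B K)"
proof -
  define t where "t = Min (x ` A)"
  have f: "finite A" "finite B" "A \<noteq> {}" "B \<noteq> {}" "A \<inter> B = {}" using fl by (auto simp: flippable_def)
  have xs: "\<And>v. 0 \<le> x v" "supp x \<in> K" "sum x (supp x) = 1" using x K by (auto simp: underlying_space_iff)
  have tle: "t \<le> x v" if "v \<in> A" for v using f that by (auto simp: t_def)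
  have "t \<in> x ` A" unfolding t_def using f by (intro Min_in) auto
  then obtain a where a: "a \<in> A" "t = x a" by auto
  have t0: "0 \<le> t" using a xs by simp
  have fin: "finite (supp x)" using xs(2) K by (auto simp: finite_simplicial_complex_def)
  show ?thesis
  \<comment> \<open>If the minimum vanishes, \<open>A\<close> is not contained in the support of
    \<open>x\<close>; there the two complexes agree and the map is the identity.\<close>
  proof (cases "t = 0")
    case True
    then have "flip_map A B x = x" by (simp add: flip_map_def t_def)
    moreover have "\<not> A \<subseteq> supp x" using a True by auto
    ultimately show ?thesis using xs finite_simplicial_complex_bistellar[OF K fl]
      by (simp add: underlying_space_iff bistellar_def)
  next
    case False
    then have tpos: "t > 0" using t0 by simp
    have "A \<subseteq> supp x" using tle tpos by force
    then have sub: "supp x \<subseteq> A \<union> B" using fl xs(2) by (auto simp: flippable_def)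
    let ?y = "flip_map A B x"
    have yv: "?y v = x v + t * (if v \<in> B then card A / card B else if v \<in> A then -1 else 0)" for v
      by (simp add: flip_map_def t_def)
    have "?y a = 0" using a f by (auto simp: yv)
    have suppy: "supp ?y \<subseteq> A \<union> B" using sub by (auto simp: yv split: if_splits)
    obtain b where b: "b \<in> B" using f by auto
    have "card A / card B > 0" using f by (simp add: card_gt_0_iff)
    then have "t * (card A / card B) > 0" using tpos by (rule mult_pos_pos[rotated])
    then have "?y b > 0" using xs(1)[of b] b unfolding yv by simp
    have "supp ?y \<in> bistellar A B K"
      using suppy \<open>?y b > 0\<close> \<open>?y a = 0\<close> a by (auto simp: bistellar_def)
    moreover have "0 \<le> ?y v" for v using xs(1)[of v] tle[of v] t0 by (auto simp: yv)
    \<comment> \<open>The factor \<open>card A / card B\<close> is chosen for this: what the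
      vertices of \<open>A\<close> lose in total is shared equally among those of
      \<open>B\<close>.\<close>
    moreover have "sum ?y (A \<union> B) = 1"
    proof -
      have "sum ?y (A \<union> B) = sum x (A \<union> B) +
          t * (\<Sum>v\<in>A \<union> B. if v \<in> B then card A / card B else if v \<in> A then -1 else 0)"
        by (simp add: yv sum.distrib sum_distrib_left)
      also have "(\<Sum>v\<in>A \<union> B. if v \<in> B then card A / card B else if v \<in> A then -1 else (0::real))
          = (\<Sum>v\<in>A. -1) + (\<Sum>v\<in>B. card A / card B)"
        unfolding sum.union_disjoint[OF f(1,2,5)]
        using f by (intro arg_cong2[where f = "(+)"] sum.cong) auto
      also have "\<dots> = 0" using f by simp
      also have "sum x (A \<union> B) = 1" using xs(3) sub f sum_eq_sum_supp[of "A \<union> B" x] by simp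
      finally show ?thesis by simp
    qed
    ultimately show ?thesis
      using suppy f by (intro underlying_spaceI[where W = "A \<union> B"] finite_simplicial_complex_bistellar K fl) auto
  qed
qed

text \<open>Since \<open>B\<close> is not a face of \<open>K\<close>, some coordinate of
  \<open>x\<close> on \<open>B\<close> is zero. After the move the least coordinate on
  \<open>B\<close> is therefore exactly the amount added there, and the reverse move scales it by
  \<open>card B / card A\<close> back to the amount taken from \<open>A\<close>.\<close>

lemma flip_map_flip_map:
  assumes K: "finite_simplicial_complex K" and fl: "flippable A B K"
    and x: "x \<in> underlying_space K"
  shows "flip_map B A (flip_map A B x) = x"
proof -
  define t where "t = Min (x ` A)"
  have f: "finite A" "finite B" "A \<noteq> {}" "B \<noteq> {}" "A \<inter> B = {}" using fl by (auto simp: flippable_def)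
  have xs: "\<And>v. 0 \<le> x v" "supp x \<in> K" using x K by (auto simp: underlying_space_iff)
  obtain b where b: "b \<in> B" "x b = 0" using not_supset_if_flippable[OF K fl xs(2)] by auto
  have "Min (x ` B) = 0" using b f xs(1) by (intro Min_eqI) force+
  have pos: "real (card A) > 0" "real (card B) > 0" using f by (auto simp: card_gt_0_iff)
  have yv: "flip_map A B x v = x v + t * (if v \<in> B then card A / card B else if v \<in> A then -1 else 0)" for v
    by (simp add: flip_map_def t_def)
  have "Min (flip_map A B x ` B) = t * (card A / card B)"
    using b f xs(1) by (intro Min_eqI) (auto simp: yv image_iff intro!: bexI[of _ b])
  then show ?thesis using pos f(5)
    by (auto simp: fun_eq_iff flip_map_def[of B A] yv divide_simps)
qed

lemma homeomorphic_bistellar: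
  assumes K: "finite_simplicial_complex K" and fl: "flippable A B K"
  shows "top_of_set (underlying_space K) homeomorphic_space top_of_set (underlying_space (bistellar A B K))"
proof -
  note K' = finite_simplicial_complex_bistellar[OF K fl] and fl' = flippable_bistellar[OF K fl]
  have "homeomorphic_maps (top_of_set (underlying_space K))
      (top_of_set (underlying_space (bistellar A B K))) (flip_map A B) (flip_map B A)"
    using flip_map_in[OF K fl] flip_map_in[OF K' fl'] flip_map_flip_map[OF K fl]
      flip_map_flip_map[OF K' fl'] continuous_on_flip_map[OF fl] continuous_on_flip_map[OF fl']
    by (auto simp: homeomorphic_maps_def bistellar_bistellar[OF K fl])
  then show ?thesis by (rule homeomorphic_maps_imp_homeomorphic_space)
qed

section \<open>Connected sums of complexes\<close>

lemma projective_plane_homeomorphic_map: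
  assumes "projective_plane P" "homeomorphic_map P Q f"
  shows "projective_plane Q"
proof -
  obtain q where q: "quotient_map (top_of_set (sphere (0 :: real^3) 1)) P q"
    "\<And>x y. x \<in> sphere 0 1 \<Longrightarrow> y \<in> sphere 0 1 \<Longrightarrow> q x = q y \<longleftrightarrow> x = y \<or> x = - y"
    using assms(1) unfolding projective_plane_def by blast
  have "q ` sphere 0 1 = topspace P" using q(1) by (auto simp: quotient_map_def)
  then have inj: "f (q x) = f (q y) \<longleftrightarrow> q x = q y" if "x \<in> sphere 0 1" "y \<in> sphere 0 1" for x y
    using assms(2) that unfolding homeomorphic_map_def inj_on_def by (metis imageI)
  have "quotient_map (top_of_set (sphere (0 :: real^3) 1)) Q (f \<circ> q)"
    using q(1) assms(2) by (intro quotient_map_compose) (auto simp: homeomorphic_map_def)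
  then show ?thesis unfolding projective_plane_def
    using q(2) inj by (intro exI[of _ "f \<circ> q"]) simp
qed

lemma connected_sum_homeomorphic_map:
  assumes "connected_sum X Y Z" "homeomorphic_map Z Z' h"
  shows "connected_sum X Y Z'"
proof -
  obtain e f q where e: "embedding_map (top_of_set (cball (0 :: real^2) 1)) X e"
    "embedding_map (top_of_set (cball (0 :: real^2) 1)) Y f"
    and D: "let D = sum_topology
                   (\<lambda>b. if b then subtopology Y (topspace Y - f ` ball 0 1)
                        else subtopology X (topspace X - e ` ball 0 1)) UNIV
         in quotient_map D Z q \<and>
            (\<forall>s\<in>topspace D. \<forall>t\<in>topspace D.
               q s = q t \<longleftrightarrow>
                 s = t \<or> (\<exists>z\<in>sphere 0 1. {s, t} = {(False, e z), (True, f z)}))"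
    using assms(1) unfolding connected_sum_def by blast
  define D where "D = sum_topology
                   (\<lambda>b. if b then subtopology Y (topspace Y - f ` ball 0 1)
                        else subtopology X (topspace X - e ` ball 0 1)) UNIV"
  have q: "quotient_map D Z q"
    and fib: "\<And>s t. s \<in> topspace D \<Longrightarrow> t \<in> topspace D \<Longrightarrow>
      q s = q t \<longleftrightarrow> s = t \<or> (\<exists>z\<in>sphere 0 1. {s, t} = {(False, e z), (True, f z)})"
    using D[folded D_def] unfolding Let_def by blast+
  have "q ` topspace D = topspace Z" using q by (auto simp: quotient_map_def)
  then have inj: "h (q s) = h (q t) \<longleftrightarrow> q s = q t" if "s \<in> topspace D" "t \<in> topspace D" for s t
    using assms(2) that unfolding homeomorphic_map_def inj_on_def by (metis imageI)
  have quot: "quotient_map D Z' (h \<circ> q)"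
    using q assms(2) by (intro quotient_map_compose) (auto simp: homeomorphic_map_def)
  show ?thesis unfolding connected_sum_def Let_def
  proof (rule exI[of _ e], rule exI[of _ f], rule exI[of _ "h \<circ> q"], fold D_def, intro conjI ballI)
    fix s t assume "s \<in> topspace D" "t \<in> topspace D"
    then show "(h \<circ> q) s = (h \<circ> q) t \<longleftrightarrow>
        s = t \<or> (\<exists>z\<in>sphere 0 1. {s, t} = {(False, e z), (True, f z)})"
      unfolding comp_apply by (simp only: inj fib)
  qed fact+
qed

text \<open>A case distinction is enough: only the outermost projective plane or connected sum is
  transported, by composing its quotient map with the homeomorphism, while the summands stay as they
  are.\<close>

lemma nonorientable_surface_homeomorphic:
  fixes X Y :: "'a topology"
  assumes "nonorientable_surface h X" "X homeomorphic_space Y"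
  shows "nonorientable_surface h Y"
proof -
  obtain f where f: "homeomorphic_map X Y f" using assms(2) by (auto simp: homeomorphic_space)
  show ?thesis using assms(1)
  proof cases
    case one
    show ?thesis unfolding one(1)
      by (rule nonorientable_surface.one[OF projective_plane_homeomorphic_map[OF one(2) f]])
  next
    case step
    show ?thesis unfolding step(1)
      by (rule nonorientable_surface.step[OF step(2,3) connected_sum_homeomorphic_map[OF step(4) f]])
  qed
qed

text \<open>To have its support inside a given face is a closed condition on a point, to have it
  equal to the face is not; so the space is written as a finite union of closed faces. Closedness
  later allows the gluing map to be tested on closed sets.\<close>

lemma closed_underlying_space:
  assumes "finite_simplicial_complex K"
  shows "closed (underlying_space K)"
proof -
  have sub: "\<tau> \<in> K" if "\<tau> \<subseteq> \<sigma>" "\<tau> \<noteq> {}" "\<sigma> \<in> K" for \<sigma> \<tau>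
    using assms that unfolding finite_simplicial_complex_def by blast
  have fin: "finite \<sigma>" if "\<sigma> \<in> K" for \<sigma> using assms that unfolding finite_simplicial_complex_def by blast
  let ?F = "\<lambda>\<sigma>. {x :: 'a \<Rightarrow> real. (\<forall>v. 0 \<le> x v) \<and> (\<forall>v. v \<notin> \<sigma> \<longrightarrow> x v = 0) \<and> sum x \<sigma> = 1}"
  have "underlying_space K = (\<Union>\<sigma>\<in>K. ?F \<sigma>)"
  proof (intro set_eqI iffI)
    fix x assume "x \<in> underlying_space K"
    then show "x \<in> (\<Union>\<sigma>\<in>K. ?F \<sigma>)" by (auto simp: underlying_space_iff[OF assms] intro!: bexI[of _ "supp x"])
  next
    fix x assume "x \<in> (\<Union>\<sigma>\<in>K. ?F \<sigma>)"
    then obtain \<sigma> where s: "\<sigma> \<in> K" "\<And>v. 0 \<le> x v" "\<And>v. v \<notin> \<sigma> \<Longrightarrow> x v = 0" "sum x \<sigma> = 1" by blast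
    have sup: "supp x \<subseteq> \<sigma>" using s(3) by auto
    have "supp x \<noteq> {}"
    proof
      assume "supp x = {}"
      then have "\<And>v. x v = 0" by auto
      then show False using s(4) by simp
    qed
    then show "x \<in> underlying_space K"
      by (intro underlying_spaceI[OF assms s(2) sub[OF sup _ s(1)] fin[OF s(1)] sup s(4)])
  qed
  moreover have c: "continuous_on UNIV (\<lambda>x :: 'a \<Rightarrow> real. x v)" for v
    by (rule continuous_on_product_coordinates)
  have "closed (?F \<sigma>)" for \<sigma>
    using c by (intro closed_Collect_conj closed_Collect_all closed_Collect_imp closed_Collect_le
        closed_Collect_eq continuous_on_sum continuous_intros) auto
  ultimately show ?thesis using assms by (auto simp: finite_simplicial_complex_def intro!: closed_UN)
qed

text \<open>A connected sum removes the image of the open disc, so that image must be known too.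
  Compact convex sets of equal dimension are homeomorphic, which settles the closed disc; that
  interiors correspond follows from invariance of domain, used for the homeomorphism and for its
  inverse.\<close>

lemma disc_onto_triangle:
  fixes a b c :: "'v::countable"
  assumes "distinct [a, b, c]"
  obtains e :: "real^2 \<Rightarrow> 'v \<Rightarrow> real" where
    "continuous_on (cball 0 1) e" "inj_on e (cball 0 1)"
    "e ` cball 0 1 = {x. (\<forall>v. 0 \<le> x v) \<and> supp x \<subseteq> {a, b, c} \<and> x a + x b + x c = 1}"
    "e ` ball 0 1 = {x. (\<forall>v. 0 \<le> x v) \<and> supp x = {a, b, c} \<and> x a + x b + x c = 1}"
proof -
  define S where "S = convex hull (insert 0 (Basis :: (real^2) set))"
  have Bas: "(Basis :: (real^2) set) = {axis 1 1, axis 2 1}"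
    by (auto simp: Basis_vec_def UNIV_2)
  have ne: "axis 1 (1::real) \<noteq> (axis 2 1 :: real^2)" by (simp add: axis_eq_axis)
  have S: "S = {p. 0 \<le> p $ 1 \<and> 0 \<le> p $ 2 \<and> p $ 1 + p $ 2 \<le> 1}"
    unfolding S_def std_simplex unfolding Bas using ne by (auto simp: inner_axis)
  have iS: "interior S = {p. 0 < p $ 1 \<and> 0 < p $ 2 \<and> p $ 1 + p $ 2 < 1}"
    unfolding S_def interior_std_simplex unfolding Bas using ne by (auto simp: inner_axis)
  have "interior S \<noteq> {}" unfolding S_def by (metis empty_iff interior_std_simplex_nonempty)
  then have "aff_dim S = aff_dim (cball (0::real^2) 1)"
    by (subst (1 2) aff_dim_nonempty_interior) auto
  moreover have "convex S" "compact S" unfolding S_def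
    by (auto intro!: finite_imp_compact_convex_hull)
  ultimately have "cball (0::real^2) 1 homeomorphic S"
    by (intro homeomorphic_convex_compact_sets) auto
  then obtain h k where hk: "homeomorphism (cball (0::real^2) 1) S h k" unfolding homeomorphic_def by blast
  then have hc: "continuous_on (cball 0 1) h" and hi: "h ` cball 0 1 = S"
    and kc: "continuous_on S k" and ki: "k ` S = cball 0 1"
    and kh: "\<And>x. x \<in> cball 0 1 \<Longrightarrow> k (h x) = x" and hk': "\<And>y. y \<in> S \<Longrightarrow> h (k y) = y"
    unfolding homeomorphism_def by auto
  have hinj: "inj_on h (cball 0 1)" by (rule inj_on_inverseI) (rule kh)
  have kinj: "inj_on k S" by (rule inj_on_inverseI) (rule hk')
  have "open (h ` ball 0 1)"
    by (rule invariance_of_domain) (auto intro: continuous_on_subset[OF hc] inj_on_subset[OF hinj])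
  then have 1: "h ` ball 0 1 \<subseteq> interior S" using hi by (intro interior_maximal) auto
  have "open (k ` interior S)"
    by (rule invariance_of_domain)
      (auto intro: continuous_on_subset[OF kc] inj_on_subset[OF kinj] interior_subset[THEN subsetD])
  moreover have "k ` interior S \<subseteq> cball 0 1" using interior_subset[of S] ki by blast
  ultimately have kb: "k ` interior S \<subseteq> ball 0 1"
    unfolding interior_cball[symmetric, of "0::real^2"] by (rule interior_maximal[rotated])
  have "interior S \<subseteq> h ` ball 0 1"
  proof
    fix y assume y: "y \<in> interior S"
    then have "h (k y) = y" using interior_subset by (intro hk') blast
    then show "y \<in> h ` ball 0 1" using kb y by (metis imageI image_subset_iff)
  qed
  with 1 have hball: "h ` ball 0 1 = interior S" by blast
  define t where "t = (\<lambda>(p::real^2) v. if v = a then p $ 1 else if v = b then p $ 2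
     else if v = c then 1 - p $ 1 - p $ 2 else 0)"
  have abc: "a \<noteq> b" "a \<noteq> c" "b \<noteq> c" "b \<noteq> a" "c \<noteq> a" "c \<noteq> b" using assms by auto
  have tinj: "inj t"
  proof (rule injI)
    fix p p' assume "t p = t p'"
    then have "t p a = t p' a" "t p b = t p' b" by simp_all
    then show "p = p'" using abc by (simp add: t_def vec_eq_iff forall_2)
  qed
  have "continuous_on X (\<lambda>p. t p v)" for X v
    unfolding t_def by (cases "v = a"; cases "v = b"; cases "v = c"; auto intro!: continuous_intros)
  then have tcont: "continuous_on X t" for X by (rule continuous_on_coordinatewise_then_product)
  have tS: "t ` S = {x. (\<forall>v. 0 \<le> x v) \<and> supp x \<subseteq> {a, b, c} \<and> x a + x b + x c = 1}"
    and tiS: "t ` interior S = {x. (\<forall>v. 0 \<le> x v) \<and> supp x = {a, b, c} \<and> x a + x b + x c = 1}"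
  proof -
    have param: "x = t (vector [x a, x b])" if "supp x \<subseteq> {a, b, c}" "x a + x b + x c = 1" for x
      using that abc by (auto simp: t_def fun_eq_iff)
    show "t ` S = {x. (\<forall>v. 0 \<le> x v) \<and> supp x \<subseteq> {a, b, c} \<and> x a + x b + x c = 1}"
    proof (intro equalityI subsetI)
      fix x assume "x \<in> {x. (\<forall>v. 0 \<le> x v) \<and> supp x \<subseteq> {a, b, c} \<and> x a + x b + x c = 1}"
      then have x: "0 \<le> x a" "0 \<le> x b" "0 \<le> x c" "supp x \<subseteq> {a, b, c}" "x a + x b + x c = 1" by auto
      then have "vector [x a, x b] \<in> S" by (auto simp: S)
      then show "x \<in> t ` S" using param[OF x(4,5)] by blast
    qed (use abc in \<open>auto simp: t_def S split: if_splits\<close>)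
    show "t ` interior S = {x. (\<forall>v. 0 \<le> x v) \<and> supp x = {a, b, c} \<and> x a + x b + x c = 1}"
    proof (intro equalityI subsetI)
      fix x assume "x \<in> {x. (\<forall>v. 0 \<le> x v) \<and> supp x = {a, b, c} \<and> x a + x b + x c = 1}"
      then have nn: "\<And>v. 0 \<le> x v" and s: "supp x = {a, b, c}" and x: "x a + x b + x c = 1" by auto
      have "x a \<noteq> 0" "x b \<noteq> 0" "x c \<noteq> 0" using s by auto
      then have "0 < x a" "0 < x b" "0 < x c" using nn by (simp_all add: less_le)
      then have "vector [x a, x b] \<in> interior S" using x by (auto simp: iS)
      then show "x \<in> t ` interior S" using param[of x] s x by blast
    next
      fix x assume "x \<in> t ` interior S"
      then obtain p where p: "0 < p $ 1" "0 < p $ 2" "p $ 1 + p $ 2 < 1" "x = t p" by (auto simp: iS)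
      then show "x \<in> {x. (\<forall>v. 0 \<le> x v) \<and> supp x = {a, b, c} \<and> x a + x b + x c = 1}"
        using abc by (auto simp: t_def split: if_splits)
    qed
  qed
  show ?thesis
  proof (rule that[of "t \<circ> h"])
    show "continuous_on (cball 0 1) (t \<circ> h)" by (rule continuous_on_compose[OF hc tcont])
    show "inj_on (t \<circ> h) (cball 0 1)" by (rule comp_inj_on[OF hinj inj_on_subset[OF tinj]]) simp
  qed (simp_all only: image_comp[symmetric] hi hball tS tiS)
qed

lemma finite_simplicial_complex_Un:
  assumes "finite_simplicial_complex K" "finite_simplicial_complex L"
  shows "finite_simplicial_complex (K \<union> L)"
proof -
  have "\<tau> \<in> K \<union> L" if "\<sigma> \<in> K \<union> L" "\<tau> \<subseteq> \<sigma>" "\<tau> \<noteq> {}" for \<sigma> \<tau>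
    using that assms unfolding finite_simplicial_complex_def by (metis UnE UnI1 UnI2)
  moreover have "finite (K \<union> L)" "\<forall>\<sigma>\<in>K \<union> L. finite \<sigma> \<and> \<sigma> \<noteq> {}"
    using assms by (auto simp: finite_simplicial_complex_def)
  ultimately show ?thesis unfolding finite_simplicial_complex_def[of "K \<union> L"] by blast
qed

text \<open>As the two complexes contain the same triangle \<open>T\<close> and meet only inside it,
  one disc map serves for both summands, the circles are glued by the identity, and the quotient map
  is the projection \<open>snd\<close> from the disjoint union onto the union.\<close>

lemma connected_sum_complex:
  fixes K\<^sub>1 K\<^sub>2 :: "'v::countable set set"
  assumes K1: "finite_simplicial_complex K\<^sub>1" and K2: "finite_simplicial_complex K\<^sub>2"
    and abc: "distinct [a, b, c]" and T: "T = {a, b, c}" and T1: "T \<in> K\<^sub>1" and T2: "T \<in> K\<^sub>2"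
    and max1: "\<And>\<sigma>. \<sigma> \<in> K\<^sub>1 \<Longrightarrow> T \<subseteq> \<sigma> \<Longrightarrow> \<sigma> = T"
    and max2: "\<And>\<sigma>. \<sigma> \<in> K\<^sub>2 \<Longrightarrow> T \<subseteq> \<sigma> \<Longrightarrow> \<sigma> = T"
    and int: "\<And>\<sigma>. \<sigma> \<in> K\<^sub>1 \<Longrightarrow> \<sigma> \<in> K\<^sub>2 \<Longrightarrow> \<sigma> \<subseteq> T"
  shows "connected_sum (top_of_set (underlying_space K\<^sub>1)) (top_of_set (underlying_space K\<^sub>2))
    (top_of_set (underlying_space (K\<^sub>1 \<union> K\<^sub>2 - {T})))"
proof -
  define W where "W b = underlying_space ((if b then K\<^sub>2 else K\<^sub>1) - {T})" for b
  have cx: "finite_simplicial_complex (K - {T})"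
    if "finite_simplicial_complex K" "\<And>\<sigma>. \<sigma> \<in> K \<Longrightarrow> T \<subseteq> \<sigma> \<Longrightarrow> \<sigma> = T" for K
  proof -
    have "\<tau> \<in> K - {T}" if "\<sigma> \<in> K - {T}" "\<tau> \<subseteq> \<sigma>" "\<tau> \<noteq> {}" for \<sigma> \<tau>
      using that \<open>finite_simplicial_complex K\<close> \<open>\<And>\<sigma>. \<sigma> \<in> K \<Longrightarrow> T \<subseteq> \<sigma> \<Longrightarrow> \<sigma> = T\<close>
      unfolding finite_simplicial_complex_def by (metis Diff_iff singleton_iff)
    then show ?thesis
      using \<open>finite_simplicial_complex K\<close> unfolding finite_simplicial_complex_def by (metis DiffE finite_Diff)
  qed
  have cW: "finite_simplicial_complex ((if b then K\<^sub>2 else K\<^sub>1) - {T})" for b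
    using cx[OF K1 max1] cx[OF K2 max2] by simp
  have K12: "finite_simplicial_complex (K\<^sub>1 \<union> K\<^sub>2 - {T})"
    unfolding Un_Diff by (rule finite_simplicial_complex_Un[OF cx[OF K1 max1] cx[OF K2 max2]])
  have W: "x \<in> W b \<longleftrightarrow> (\<forall>v. 0 \<le> x v) \<and> supp x \<in> (if b then K\<^sub>2 else K\<^sub>1) \<and> supp x \<noteq> T \<and> sum x (supp x) = 1"
    for x b using underlying_space_iff[OF cW, of x b] by (auto simp: W_def)
  have Z: "underlying_space (K\<^sub>1 \<union> K\<^sub>2 - {T}) = W False \<union> W True"
    by (auto simp: W underlying_space_iff[OF K12])
  obtain e :: "real^2 \<Rightarrow> 'v \<Rightarrow> real" where e: "continuous_on (cball 0 1) e" "inj_on e (cball 0 1)"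
    and ec: "e ` cball 0 1 = {x. (\<forall>v. 0 \<le> x v) \<and> supp x \<subseteq> {a, b, c} \<and> x a + x b + x c = 1}"
    and eb: "e ` ball 0 1 = {x. (\<forall>v. 0 \<le> x v) \<and> supp x = {a, b, c} \<and> x a + x b + x c = 1}"
    using disc_onto_triangle[OF abc] by blast
  have sum3: "x a + x b + x c = sum x (supp x)" if "supp x \<subseteq> {a, b, c}" for x :: "'v \<Rightarrow> real"
    using sum_eq_sum_supp[OF _ that] abc by simp
  have emb: "embedding_map (top_of_set (cball 0 1)) (top_of_set (underlying_space K)) e"
    if "finite_simplicial_complex K" "T \<in> K" for K
  proof -
    have "e ` cball 0 1 \<subseteq> underlying_space K"
    proof
      fix x assume "x \<in> e ` cball 0 1"
      then have x: "\<And>v. 0 \<le> x v" "supp x \<subseteq> {a, b, c}" "x a + x b + x c = 1" by (auto simp: ec)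
      have "supp x \<noteq> {}"
      proof
        assume "supp x = {}" then have "x a = 0" "x b = 0" "x c = 0" by auto
        then show False using x by simp
      qed
      then have "supp x \<in> K" using that x(2) unfolding finite_simplicial_complex_def T by blast
      then show "x \<in> underlying_space K" using that x sum3[OF x(2)] by (simp add: underlying_space_iff)
    qed
    then have cont: "continuous_map (top_of_set (cball 0 1)) (top_of_set (underlying_space K)) e"
      using e(1) by (auto simp: continuous_map_in_subtopology)
    moreover have "closed_map (top_of_set (cball 0 1)) (top_of_set (underlying_space K)) e"
      by (rule continuous_imp_closed_map_gen[OF _ _ cont])
        (auto simp: compact_space_subtopology intro!: Hausdorff_imp_kc_space Hausdorff_space_subtopology)
    ultimately show ?thesis using e(2) by (intro injective_closed_imp_embedding_map) auto
  qed
  have rest: "underlying_space (if b then K\<^sub>2 else K\<^sub>1) - e ` ball 0 1 = W b" for b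
    using K1 K2 sum3 unfolding eb by (auto simp: W underlying_space_iff T)
  have cut: "subtopology (top_of_set U) (topspace (top_of_set U) - B) = top_of_set (U - B)" for U B :: "('v \<Rightarrow> real) set"
    by (simp add: subtopology_subtopology Int_absorb1)
  define D where "D = sum_topology (\<lambda>b. top_of_set (W b)) UNIV"
  have D: "sum_topology (\<lambda>b. if b then subtopology (top_of_set (underlying_space K\<^sub>2))
        (topspace (top_of_set (underlying_space K\<^sub>2)) - e ` ball 0 1)
      else subtopology (top_of_set (underlying_space K\<^sub>1))
        (topspace (top_of_set (underlying_space K\<^sub>1)) - e ` ball 0 1)) UNIV = D"
    unfolding D_def cut using rest[of True] rest[of False]
    by (intro arg_cong2[where f = sum_topology] ext) auto
  have topD: "topspace D = Sigma UNIV W" by (auto simp: D_def)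
  have clW: "closed (W b)" for b unfolding W_def by (rule closed_underlying_space[OF cW])
  \<comment> \<open>Both pieces are closed, so a subset of their union is closed iff its traces on
    the two pieces are; this is the quotient property stated for closed sets.\<close>
  have "quotient_map D (top_of_set (W False \<union> W True)) snd"
    unfolding quotient_map_closedin
  proof (intro conjI allI impI)
    show "snd ` topspace D = topspace (top_of_set (W False \<union> W True))"
      unfolding topD by (force simp: image_iff UNIV_bool)
    fix U assume "U \<subseteq> topspace (top_of_set (W False \<union> W True))"
    then have U: "U = U \<inter> W False \<union> U \<inter> W True" by auto
    have pre: "{x. (b, x) \<in> {x \<in> topspace D. snd x \<in> U}} = U \<inter> W b" for b
      by (auto simp: topD)
    have "closedin D {x \<in> topspace D. snd x \<in> U} \<longleftrightarrow> (\<forall>b. closedin (top_of_set (W b)) (U \<inter> W b))"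
      unfolding D_def closedin_sum_topology unfolding D_def[symmetric] pre
      by (auto simp: topD)
    also have "\<dots> \<longleftrightarrow> (\<forall>b. closed (U \<inter> W b))"
      using clW by (simp add: closedin_closed_eq)
    also have "\<dots> \<longleftrightarrow> closed U"
      using U clW by (metis closed_Int closed_Un)
    also have "\<dots> \<longleftrightarrow> closedin (top_of_set (W False \<union> W True)) U"
      using U clW by (subst closedin_closed_eq) auto
    finally show "closedin D {x \<in> topspace D. snd x \<in> U} = closedin (top_of_set (W False \<union> W True)) U" .
  qed
  moreover have "snd s = snd t \<longleftrightarrow> s = t \<or> (\<exists>z\<in>sphere 0 1. {s, t} = {(False, e z), (True, e z)})"
    if "s \<in> topspace D" "t \<in> topspace D" for s t
  proof -
    obtain b x b' x' where st: "s = (b, x)" "t = (b', x')" by (metis surj_pair)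
    have xW: "x \<in> W b" "x' \<in> W b'" using that by (auto simp: st topD)
    \<comment> \<open>The support of a point in both pieces is a face of both complexes, hence a
      proper face of \<open>T\<close>; such points form the boundary circle of the disc.\<close>
    have "\<exists>z\<in>sphere 0 1. x = e z" if "x = x'" "b \<noteq> b'"
    proof -
      have "x \<in> W False" "x \<in> W True" using xW that by (cases b; cases b'; simp)+
      then have "supp x \<in> K\<^sub>1" "supp x \<in> K\<^sub>2" "supp x \<noteq> T" "\<And>v. 0 \<le> x v" "sum x (supp x) = 1"
        by (auto simp: W)
      then have "x \<in> e ` cball 0 1 - e ` ball 0 1"
        using int[of "supp x"] sum3[of x] unfolding ec eb T by auto
      then obtain z where z: "z \<in> cball 0 1" "z \<notin> ball 0 1" "x = e z" by blast
      then show ?thesis by (intro bexI[of _ z]) auto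
    qed
    then show ?thesis by (cases b; cases b') (auto simp: st doubleton_eq_iff)
  qed
  ultimately show ?thesis unfolding connected_sum_def Let_def Z
    by (rule_tac exI[of _ e], rule_tac exI[of _ e], rule_tac exI[of _ snd])
      (unfold D, use emb[OF K1 T1] emb[OF K2 T2] in blast)
qed

section \<open>The six-vertex projective plane\<close>

definition complex_of :: "'v list list \<Rightarrow> 'v set set" where
  "complex_of L = {\<sigma>. \<sigma> \<noteq> {} \<and> (\<exists>T\<in>set L. \<sigma> \<subseteq> set T)}"

lemma finite_simplicial_complex_complex_of: "finite_simplicial_complex (complex_of L)"
proof -
  have "complex_of L \<subseteq> (\<Union>T\<in>set L. Pow (set T))" by (auto simp: complex_of_def)
  then have "finite (complex_of L)" by (rule finite_subset) auto
  moreover have "\<tau> \<in> complex_of L" if "\<sigma> \<in> complex_of L" "\<tau> \<subseteq> \<sigma>" "\<tau> \<noteq> {}" for \<sigma> \<tau>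
    using that unfolding complex_of_def by (auto dest: subset_trans)
  moreover have "finite \<sigma> \<and> \<sigma> \<noteq> {}" if "\<sigma> \<in> complex_of L" for \<sigma>
    using that by (auto simp: complex_of_def intro: finite_subset)
  ultimately show ?thesis unfolding finite_simplicial_complex_def by blast
qed

text \<open>A triangulated Moebius band. The first three triangles are triangular faces of the
  cuboctahedron, the other six are halves of square faces. In each list the vertices stand in the
  order of the parameters \<open>p\<close>, \<open>q\<close>, \<open>r\<close> of the corresponding
  rule of \<open>in_cone\<close>.\<close>

definition pinched_rp2 :: "'v \<Rightarrow> 'v \<Rightarrow> 'v \<Rightarrow> 'v \<Rightarrow> 'v \<Rightarrow> 'v \<Rightarrow> 'v list list" where
  "pinched_rp2 a b c x y z = [[a, y, z], [x, b, z], [x, y, c], [a, x, c], [a, x, z],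
     [b, y, a], [b, y, x], [c, z, b], [c, z, y]]"

definition rp2 :: "'v \<Rightarrow> 'v \<Rightarrow> 'v \<Rightarrow> 'v \<Rightarrow> 'v \<Rightarrow> 'v \<Rightarrow> 'v list list" where
  "rp2 a b c x y z = [a, b, c] # pinched_rp2 a b c x y z"

text \<open>
  The vertices \<open>a, b, c, x, y, z\<close> of \<open>rp2\<close> stand for the pairs of antipodal points
  \<open>\<plusminus>(1, 1, 0)\<close>, \<open>\<plusminus>(0, 1, 1)\<close>, \<open>\<plusminus>(1, 0, 1)\<close>, \<open>\<plusminus>(1, -1, 0)\<close>, \<open>\<plusminus>(0, 1, -1)\<close>, \<open>\<plusminus>(-1, 0, 1)\<close>, and
  \<open>tent u v w\<close> is the coordinate of the point \<open>(u, v, w)\<close> at the first of these.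
\<close>

definition tent :: "real \<Rightarrow> real \<Rightarrow> real \<Rightarrow> real" where
  "tent u v w = max 0 (min ((u + v - \<bar>w\<bar>) / 2) u) + max 0 (min ((- u - v - \<bar>w\<bar>) / 2) (- u))"

lemma tent_minus: "tent (- u) (- v) (- w) = tent u v w"
  by (simp add: tent_def algebra_simps)

lemma tent_nonneg: "0 \<le> tent u v w"
  by (simp add: tent_def)

lemma tent_scale:
  assumes "0 < t"
  shows "tent (t * u) (t * v) (t * w) = t * tent u v w"
proof -
  have "\<bar>t * w\<bar> = t * \<bar>w\<bar>" using assms by (simp add: abs_mult)
  moreover have "t * max 0 y = max 0 (t * y)" "t * min y z = min (t * y) (t * z)" for y z
    using assms by (auto simp: max_def min_def zero_le_mult_iff)
  ultimately show ?thesis by (simp add: tent_def distrib_left right_diff_distrib)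
qed

text \<open>
  The cones from the origin over one triangle of each antipodal pair on the cuboctahedron.
\<close>

inductive in_cone :: "real \<Rightarrow> real \<Rightarrow> real \<Rightarrow> bool" where
  "0 \<le> p \<Longrightarrow> 0 \<le> q \<Longrightarrow> 0 \<le> r \<Longrightarrow> in_cone (p + r) (p + q) (q + r)"
| "0 \<le> p \<Longrightarrow> 0 \<le> q \<Longrightarrow> 0 \<le> r \<Longrightarrow> in_cone (p + r) (p + q) (- q - r)"
| "0 \<le> p \<Longrightarrow> 0 \<le> q \<Longrightarrow> 0 \<le> r \<Longrightarrow> in_cone (p + r) (- p - q) (q + r)"
| "0 \<le> p \<Longrightarrow> 0 \<le> q \<Longrightarrow> 0 \<le> r \<Longrightarrow> in_cone (- p - r) (p + q) (q + r)"
| "0 \<le> p \<Longrightarrow> 0 \<le> q \<Longrightarrow> 0 \<le> r \<Longrightarrow> in_cone (p + q + r) (p - q) r"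
| "0 \<le> p \<Longrightarrow> 0 \<le> q \<Longrightarrow> 0 \<le> r \<Longrightarrow> in_cone (p + q + r) (p - q) (- r)"
| "0 \<le> p \<Longrightarrow> 0 \<le> q \<Longrightarrow> 0 \<le> r \<Longrightarrow> in_cone r (p + q + r) (p - q)"
| "0 \<le> p \<Longrightarrow> 0 \<le> q \<Longrightarrow> 0 \<le> r \<Longrightarrow> in_cone (- r) (p + q + r) (p - q)"
| "0 \<le> p \<Longrightarrow> 0 \<le> q \<Longrightarrow> 0 \<le> r \<Longrightarrow> in_cone (p - q) r (p + q + r)"
| "0 \<le> p \<Longrightarrow> 0 \<le> q \<Longrightarrow> 0 \<le> r \<Longrightarrow> in_cone (p - q) (- r) (p + q + r)"

section \<open>The ten cones and their antipodes fill the space\<close>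

lemma in_cone_triangle:
  assumes "\<bar>u\<bar> \<le> \<bar>v\<bar> + \<bar>w\<bar>" "\<bar>v\<bar> \<le> \<bar>u\<bar> + \<bar>w\<bar>" "\<bar>w\<bar> \<le> \<bar>u\<bar> + \<bar>v\<bar>"
    "0 \<le> u \<and> 0 \<le> v \<or> 0 \<le> u \<and> 0 \<le> w \<or> 0 \<le> v \<and> 0 \<le> w"
  shows "in_cone u v w"
proof -
  let ?p = "(\<bar>u\<bar> + \<bar>v\<bar> - \<bar>w\<bar>) / 2" and ?q = "(\<bar>v\<bar> + \<bar>w\<bar> - \<bar>u\<bar>) / 2" and ?r = "(\<bar>u\<bar> + \<bar>w\<bar> - \<bar>v\<bar>) / 2"
  have eq: "?p + ?r = \<bar>u\<bar>" "?p + ?q = \<bar>v\<bar>" "?q + ?r = \<bar>w\<bar>"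
    "- ?q - ?r = - \<bar>w\<bar>" "- ?p - ?q = - \<bar>v\<bar>" "- ?p - ?r = - \<bar>u\<bar>" by (simp_all add: field_simps)
  have "0 \<le> ?p" "0 \<le> ?q" "0 \<le> ?r" using assms by simp_all
  note * = in_cone.intros(1-4)[OF this, unfolded eq]
  consider "0 \<le> u" "0 \<le> v" "0 \<le> w" | "0 \<le> u" "0 \<le> v" "w \<le> 0" | "0 \<le> u" "v \<le> 0" "0 \<le> w" | "u \<le> 0" "0 \<le> v" "0 \<le> w"
    using assms(4) by linarith
  then show ?thesis using * by cases (simp_all add: abs_of_nonpos)
qed

text \<open>A square face belongs to the coordinate that dominates the other two, and the sign of
  \<open>w\<close> tells on which side of its diagonal the point lies. The three conclusions are the
  three cyclic positions of the dominating coordinate.\<close>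

lemma in_cone_square:
  assumes "\<bar>v\<bar> + \<bar>w\<bar> \<le> u"
  shows "in_cone u v w" "in_cone w u v" "in_cone v w u"
proof -
  let ?p = "(u - \<bar>w\<bar> + v) / 2" and ?q = "(u - \<bar>w\<bar> - v) / 2" and ?r = "\<bar>w\<bar>"
  have eq: "?p + ?q + ?r = u" "?p - ?q = v" by (simp_all add: field_simps)
  have "0 \<le> ?p" "0 \<le> ?q" "0 \<le> ?r" using assms by (simp_all add: field_simps)
  note * = in_cone.intros(5-10)[OF this, unfolded eq]
  show "in_cone u v w" "in_cone w u v" "in_cone v w u"
    using * by (cases "0 \<le> w"; simp)+
qed

text \<open>Either one coordinate dominates, which gives a square face, or the absolute values
  satisfy the triangle inequalities, which gives a triangular face. In the latter case two
  coordinates share a sign, and up to the antipodal map that sign is nonnegative.\<close>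

lemma in_cone_cases: "in_cone u v w \<or> in_cone (- u) (- v) (- w)"
proof -
  consider "\<bar>v\<bar> + \<bar>w\<bar> \<le> u" | "\<bar>w\<bar> + \<bar>u\<bar> \<le> v" | "\<bar>u\<bar> + \<bar>v\<bar> \<le> w"
    | "\<bar>- v\<bar> + \<bar>- w\<bar> \<le> - u" | "\<bar>- w\<bar> + \<bar>- u\<bar> \<le> - v" | "\<bar>- u\<bar> + \<bar>- v\<bar> \<le> - w"
    | "\<bar>u\<bar> \<le> \<bar>v\<bar> + \<bar>w\<bar>" "\<bar>v\<bar> \<le> \<bar>u\<bar> + \<bar>w\<bar>" "\<bar>w\<bar> \<le> \<bar>u\<bar> + \<bar>v\<bar>"
    by (smt (verit))
  then show ?thesis
  proof cases
    case 7
    have "(0 \<le> u \<and> 0 \<le> v \<or> 0 \<le> u \<and> 0 \<le> w \<or> 0 \<le> v \<and> 0 \<le> w)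
      \<or> (0 \<le> - u \<and> 0 \<le> - v \<or> 0 \<le> - u \<and> 0 \<le> - w \<or> 0 \<le> - v \<and> 0 \<le> - w)" by linarith
    then show ?thesis using in_cone_triangle[of u v w] in_cone_triangle[of "- u" "- v" "- w"] 7 by auto
  qed (blast dest: in_cone_square)+
qed

text \<open>The pattern of diagonals is invariant under cyclic shifts of the axes and under sign
  changes of single coordinates. These symmetries carry the first vertex pair to the other five, so
  \<open>tent\<close> yields all six coordinates.\<close>

definition tents :: "real \<Rightarrow> real \<Rightarrow> real \<Rightarrow> real list" where
  "tents u v w = [tent u v w, tent v w u, tent w u v, tent u (- v) w, tent v (- w) u, tent w (- u) v]"

lemma tent_eq_0:
  assumes "u + v \<le> \<bar>w\<bar> \<or> u \<le> 0" "- u - v \<le> \<bar>w\<bar> \<or> 0 \<le> u"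
  shows "tent u v w = 0"
proof -
  have "min ((u + v - \<bar>w\<bar>) / 2) u \<le> 0" "min ((- u - v - \<bar>w\<bar>) / 2) (- u) \<le> 0"
    using assms by (auto simp: min_le_iff_disj)
  then show ?thesis by (simp add: tent_def)
qed

text \<open>The disjunctions of \<open>tent_eq_0\<close> are resolved into separate rules with
  linear premises. Together with the rules below there is one rule per branch of
  \<open>tent\<close>, and \<open>linarith\<close> decides which of them applies on a given
  cone.\<close>

lemma tent_eq_0_pos: "0 \<le> u \<Longrightarrow> u + v \<le> \<bar>w\<bar> \<Longrightarrow> tent u v w = 0"
  by (rule tent_eq_0) simp_all

lemma tent_eq_0_neg: "u \<le> 0 \<Longrightarrow> - u - v \<le> \<bar>w\<bar> \<Longrightarrow> tent u v w = 0"
  by (rule tent_eq_0) simp_all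

lemma tent_eq_0_mid: "u + v \<le> \<bar>w\<bar> \<Longrightarrow> - u - v \<le> \<bar>w\<bar> \<Longrightarrow> tent u v w = 0"
  by (rule tent_eq_0) simp_all

text \<open>Four of the five triangles around the vertex \<open>(1, 1, 0)\<close> have this form as
  coordinate. The fifth is half of a square whose diagonal misses the vertex, and there the
  coordinate is \<open>u\<close>, as in \<open>tent_eq_first\<close>; the minimum in
  \<open>tent\<close> selects between the two. The primed rules treat the antipode.\<close>

lemma tent_eq_half:
  assumes "\<bar>w\<bar> \<le> u + v" "v - \<bar>w\<bar> \<le> u" "2 * t = u + v - \<bar>w\<bar>"
  shows "tent u v w = t"
proof -
  have "min ((u + v - \<bar>w\<bar>) / 2) u = t" "min ((- u - v - \<bar>w\<bar>) / 2) (- u) \<le> 0" "0 \<le> t"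
    using assms by (auto simp: min_le_iff_disj min_def)
  then show ?thesis by (simp add: tent_def)
qed

lemma tent_eq_first:
  assumes "0 \<le> u" "u \<le> v - \<bar>w\<bar>" "t = u"
  shows "tent u v w = t"
proof -
  have "min ((u + v - \<bar>w\<bar>) / 2) u = t" "min ((- u - v - \<bar>w\<bar>) / 2) (- u) \<le> 0"
    using assms by (auto simp: min_le_iff_disj min_def)
  then show ?thesis using assms by (simp add: tent_def)
qed

lemma tent_eq_half':
  assumes "\<bar>w\<bar> \<le> - u - v" "- v - \<bar>w\<bar> \<le> - u" "2 * t = - u - v - \<bar>w\<bar>"
  shows "tent u v w = t"
  using assms tent_eq_half[of "- w" "- u" "- v" t] tent_minus[of u v w] by simp

lemma tent_eq_first':
  assumes "u \<le> 0" "- u \<le> - v - \<bar>w\<bar>" "t = - u"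
  shows "tent u v w = t"
  using assms tent_eq_first[of "- u" "- v" "- w" t] tent_minus[of u v w] by simp

text \<open>Used in both directions: it confines the support of an image point to a facet, and it
  supplies a preimage for every point of a facet.\<close>

lemma tents_cones:
  assumes "0 \<le> p" "0 \<le> q" "0 \<le> r"
  shows "tents (p + r) (p + q) (q + r) = [p, q, r, 0, 0, 0]"
    "tents (p + r) (p + q) (- q - r) = [p, 0, 0, 0, q, r]"
    "tents (p + r) (- p - q) (q + r) = [0, 0, r, p, q, 0]"
    "tents (- p - r) (p + q) (q + r) = [0, q, 0, p, 0, r]"
    "tents (p + q + r) (p - q) r = [p, 0, r, q, 0, 0]"
    "tents (p + q + r) (p - q) (- r) = [p, 0, 0, q, 0, r]"
    "tents r (p + q + r) (p - q) = [r, p, 0, 0, q, 0]"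
    "tents (- r) (p + q + r) (p - q) = [0, p, 0, r, q, 0]"
    "tents (p - q) r (p + q + r) = [0, r, p, 0, 0, q]"
    "tents (p - q) (- r) (p + q + r) = [0, 0, p, 0, r, q]"
proof -
  show "tents (p + r) (p + q) (q + r) = [p, q, r, 0, 0, 0]"
    unfolding tents_def list.inject by (intro conjI refl; insert assms;
        (rule tent_eq_0_pos; linarith | rule tent_eq_0_mid; linarith | rule tent_eq_0_neg; linarith | rule tent_eq_half; linarith | rule tent_eq_first; linarith |
         rule tent_eq_half'; linarith | rule tent_eq_first'; linarith))
  show "tents (p + r) (p + q) (- q - r) = [p, 0, 0, 0, q, r]"
    unfolding tents_def list.inject by (intro conjI refl; insert assms;
        (rule tent_eq_0_pos; linarith | rule tent_eq_0_mid; linarith | rule tent_eq_0_neg; linarith | rule tent_eq_half; linarith | rule tent_eq_first; linarith |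
         rule tent_eq_half'; linarith | rule tent_eq_first'; linarith))
  show "tents (p + r) (- p - q) (q + r) = [0, 0, r, p, q, 0]"
    unfolding tents_def list.inject by (intro conjI refl; insert assms;
        (rule tent_eq_0_pos; linarith | rule tent_eq_0_mid; linarith | rule tent_eq_0_neg; linarith | rule tent_eq_half; linarith | rule tent_eq_first; linarith |
         rule tent_eq_half'; linarith | rule tent_eq_first'; linarith))
  show "tents (- p - r) (p + q) (q + r) = [0, q, 0, p, 0, r]"
    unfolding tents_def list.inject by (intro conjI refl; insert assms;
        (rule tent_eq_0_pos; linarith | rule tent_eq_0_mid; linarith | rule tent_eq_0_neg; linarith | rule tent_eq_half; linarith | rule tent_eq_first; linarith |
         rule tent_eq_half'; linarith | rule tent_eq_first'; linarith))
  show "tents (p + q + r) (p - q) r = [p, 0, r, q, 0, 0]"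
    unfolding tents_def list.inject by (intro conjI refl; insert assms;
        (rule tent_eq_0_pos; linarith | rule tent_eq_0_mid; linarith | rule tent_eq_0_neg; linarith | rule tent_eq_half; linarith | rule tent_eq_first; linarith |
         rule tent_eq_half'; linarith | rule tent_eq_first'; linarith))
  show "tents (p + q + r) (p - q) (- r) = [p, 0, 0, q, 0, r]"
    unfolding tents_def list.inject by (intro conjI refl; insert assms;
        (rule tent_eq_0_pos; linarith | rule tent_eq_0_mid; linarith | rule tent_eq_0_neg; linarith | rule tent_eq_half; linarith | rule tent_eq_first; linarith |
         rule tent_eq_half'; linarith | rule tent_eq_first'; linarith))
  show "tents r (p + q + r) (p - q) = [r, p, 0, 0, q, 0]"
    unfolding tents_def list.inject by (intro conjI refl; insert assms;
        (rule tent_eq_0_pos; linarith | rule tent_eq_0_mid; linarith | rule tent_eq_0_neg; linarith | rule tent_eq_half; linarith | rule tent_eq_first; linarith |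
         rule tent_eq_half'; linarith | rule tent_eq_first'; linarith))
  show "tents (- r) (p + q + r) (p - q) = [0, p, 0, r, q, 0]"
    unfolding tents_def list.inject by (intro conjI refl; insert assms;
        (rule tent_eq_0_pos; linarith | rule tent_eq_0_mid; linarith | rule tent_eq_0_neg; linarith | rule tent_eq_half; linarith | rule tent_eq_first; linarith |
         rule tent_eq_half'; linarith | rule tent_eq_first'; linarith))
  show "tents (p - q) r (p + q + r) = [0, r, p, 0, 0, q]"
    unfolding tents_def list.inject by (intro conjI refl; insert assms;
        (rule tent_eq_0_pos; linarith | rule tent_eq_0_mid; linarith | rule tent_eq_0_neg; linarith | rule tent_eq_half; linarith | rule tent_eq_first; linarith |
         rule tent_eq_half'; linarith | rule tent_eq_first'; linarith))
  show "tents (p - q) (- r) (p + q + r) = [0, 0, p, 0, r, q]"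
    unfolding tents_def list.inject by (intro conjI refl; insert assms;
        (rule tent_eq_0_pos; linarith | rule tent_eq_0_mid; linarith | rule tent_eq_0_neg; linarith | rule tent_eq_half; linarith | rule tent_eq_first; linarith |
         rule tent_eq_half'; linarith | rule tent_eq_first'; linarith))
qed

lemma tents_minus: "tents (- u) (- v) (- w) = tents u v w"
  using tent_minus[of u v w] tent_minus[of v w u] tent_minus[of w u v]
    tent_minus[of u "- v" w] tent_minus[of v "- w" u] tent_minus[of w "- u" v]
  by (simp add: tents_def)

text \<open>The sum \<open>p + q + r\<close> is the later normalizing divisor, and the implication
  about it keeps that divisor positive away from the origin.\<close>

lemma tents_in_cone:
  assumes "in_cone u v w"
  shows "\<exists>p q r. 0 \<le> p \<and> 0 \<le> q \<and> 0 \<le> r \<and> (p + q + r = 0 \<longrightarrow> u = 0 \<and> v = 0 \<and> w = 0) \<and>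
    tents u v w \<in> {[p, q, r, 0, 0, 0], [p, 0, 0, 0, q, r], [0, 0, r, p, q, 0], [0, q, 0, p, 0, r],
      [p, 0, r, q, 0, 0], [p, 0, 0, q, 0, r], [r, p, 0, 0, q, 0], [0, p, 0, r, q, 0],
      [0, r, p, 0, 0, q], [0, 0, p, 0, r, q]}"
  using assms
  by cases (rule exI, rule exI, rule exI, intro conjI, assumption, assumption, assumption, force,
    simp only: tents_cones insert_iff simp_thms)+

lemma tents_cases:
  "\<exists>p q r. 0 \<le> p \<and> 0 \<le> q \<and> 0 \<le> r \<and> (p + q + r = 0 \<longrightarrow> u = 0 \<and> v = 0 \<and> w = 0) \<and>
    tents u v w \<in> {[p, q, r, 0, 0, 0], [p, 0, 0, 0, q, r], [0, 0, r, p, q, 0], [0, q, 0, p, 0, r],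
      [p, 0, r, q, 0, 0], [p, 0, 0, q, 0, r], [r, p, 0, 0, q, 0], [0, p, 0, r, q, 0],
      [0, r, p, 0, 0, q], [0, 0, p, 0, r, q]}"
  using in_cone_cases[of u v w]
proof
  assume "in_cone (- u) (- v) (- w)"
  from tents_in_cone[OF this] show ?thesis unfolding tents_minus neg_equal_0_iff_equal .
qed (rule tents_in_cone)

text \<open>
  Any two of the six vertices span an edge, so the relative sign of the corresponding lines
  through the origin is determined, and the products of coordinates can be recovered.
\<close>

lemma products_in_cone:
  assumes "in_cone u v w" "tents u v w = [A, B, C, X, Y, Z]"
  shows "u * u = (A + X + C + Z)\<^sup>2 - 4 * C * Z \<and>
    v * v = (B + Y + A + X)\<^sup>2 - 4 * A * X \<and>
    w * w = (C + Z + B + Y)\<^sup>2 - 4 * B * Y \<and>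
    u * v = A * A - X * X + A * B + A * Y - X * B - X * Y + C * B - C * Y + C * A - C * X
      - Z * B + Z * Y + Z * A - Z * X \<and>
    v * w = B * B - Y * Y + B * C + B * Z - Y * C - Y * Z + A * C - A * Z + A * B - A * Y
      - X * C + X * Z + X * B - X * Y \<and>
    w * u = C * C - Z * Z + C * A + C * X - Z * A - Z * X + B * A - B * X + B * C - B * Z
      - Y * A + Y * X + Y * C - Y * Z"
  using assms
  by cases (simp only: tents_cones list.inject, clarify, simp add: power2_eq_square algebra_simps)+

lemma products_of_tents:
  assumes "tents u v w = [A, B, C, X, Y, Z]"
  shows "u * u = (A + X + C + Z)\<^sup>2 - 4 * C * Z \<and>
    v * v = (B + Y + A + X)\<^sup>2 - 4 * A * X \<and>
    w * w = (C + Z + B + Y)\<^sup>2 - 4 * B * Y \<and>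
    u * v = A * A - X * X + A * B + A * Y - X * B - X * Y + C * B - C * Y + C * A - C * X
      - Z * B + Z * Y + Z * A - Z * X \<and>
    v * w = B * B - Y * Y + B * C + B * Z - Y * C - Y * Z + A * C - A * Z + A * B - A * Y
      - X * C + X * Z + X * B - X * Y \<and>
    w * u = C * C - Z * Z + C * A + C * X - Z * A - Z * X + B * A - B * X + B * C - B * Z
      - Y * A + Y * X + Y * C - Y * Z"
  using in_cone_cases[of u v w]
proof
  assume "in_cone (- u) (- v) (- w)"
  from products_in_cone[OF this] assms show ?thesis by (simp add: tents_minus)
qed (rule products_in_cone[OF _ assms])

text \<open>By \<open>products_of_tents\<close> the tents determine all products of two coordinates
  of the vector, and these determine the vector up to a common sign.\<close>

lemma tents_eq_iff:
  "tents u v w = tents u' v' w' \<longleftrightarrow>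
    u = u' \<and> v = v' \<and> w = w' \<or> u = - u' \<and> v = - v' \<and> w = - w'"
proof
  assume eq: "tents u v w = tents u' v' w'"
  obtain A B C X Y Z where "tents u v w = [A, B, C, X, Y, Z]" by (simp add: tents_def)
  note products_of_tents[OF this] products_of_tents[OF this[unfolded eq]]
  then have sq: "u * u = u' * u'" "v * v = v' * v'" "w * w = w' * w'"
    and mix: "u * v = u' * v'" "v * w = v' * w'" "w * u = w' * u'" by simp_all
  \<comment> \<open>The pairs \<open>(s, t)\<close> and \<open>(s', t')\<close> are parallel: the
    square of their determinant expands into the given products and cancels.\<close>
  have cross: "s * t' = t * s'" if "s * s = s' * s'" "t * t = t' * t'" "s * t = s' * t'" for s s' t t' :: real
  proof -
    have "(s * t' - t * s')\<^sup>2 = (s * s) * (t' * t') + (t * t) * (s' * s') - 2 * (s * t) * (s' * t')"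
      by (simp add: power2_eq_square algebra_simps)
    also have "\<dots> = 0" unfolding that by (simp add: algebra_simps)
    finally show ?thesis by simp
  qed
  have prod: "(s - s') * (t + t') = 0" if "s * t = s' * t'" "s * t' = t * s'" for s s' t t' :: real
    using that by (simp add: algebra_simps)
  note c = cross[OF sq(1,2) mix(1)] cross[OF sq(2,3) mix(2)] cross[OF sq(3,1) mix(3)]
  have opp: "s = s' \<or> u = - u' \<and> v = - v' \<and> w = - w'" if "(s - s') * (u + u') = 0"
    "(s - s') * (v + v') = 0" "(s - s') * (w + w') = 0" for s s'
    using that by (auto simp: add_eq_0_iff2)
  have "u = u' \<or> u = - u' \<and> v = - v' \<and> w = - w'"
    using c mix by (intro opp prod sq) (simp_all add: mult.commute)
  moreover have "v = v' \<or> u = - u' \<and> v = - v' \<and> w = - w'"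
    using c mix by (intro opp prod sq) (simp_all add: mult.commute)
  moreover have "w = w' \<or> u = - u' \<and> v = - v' \<and> w = - w'"
    using c mix by (intro opp prod sq) (simp_all add: mult.commute)
  ultimately show "u = u' \<and> v = v' \<and> w = w' \<or> u = - u' \<and> v = - v' \<and> w = - w'" by blast
qed (auto simp: tents_minus)

section \<open>The antipodal quotient of the sphere\<close>

definition place :: "'v list \<Rightarrow> real list \<Rightarrow> 'v \<Rightarrow> real" where
  "place vs rs v = (case map_of (zip vs rs) v of None \<Rightarrow> 0 | Some r \<Rightarrow> r)"

text \<open>The map \<open>f\<close> is homogeneous of degree one under positive scaling and
  identifies exactly opposite vectors. Dividing by the coordinate sum \<open>N\<close> takes the
  place of radial projection from the sphere to the cuboctahedron.\<close>

lemma projective_plane_rp2: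
  fixes a b c x y z :: "'v::countable"
  assumes "distinct [a, b, c, x, y, z]"
  shows "projective_plane (top_of_set (underlying_space (complex_of (rp2 a b c x y z))))"
proof -
  let ?V = "[a, b, c, x, y, z]" and ?K = "complex_of (rp2 a b c x y z)"
  define T where "T s = tents (s $ 1) (s $ 2) (s $ 3)" for s :: "real^3"
  define f where "f s = place ?V (T s)" for s
  have dist: "a \<noteq> b" "a \<noteq> c" "a \<noteq> x" "a \<noteq> y" "a \<noteq> z" "b \<noteq> c" "b \<noteq> x" "b \<noteq> y" "b \<noteq> z"
    "c \<noteq> x" "c \<noteq> y" "c \<noteq> z" "x \<noteq> y" "x \<noteq> z" "y \<noteq> z" using assms by auto
  note dist = dist dist[symmetric]
  have place: "place ?V [A, B, C, X, Y, Z] v = (if v = a then A else if v = b then B else if v = c then C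
      else if v = x then X else if v = y then Y else if v = z then Z else 0)" for A B C X Y Z v
    by (simp add: place_def)
  have place_eq: "place ?V [A, B, C, X, Y, Z] = place ?V [A', B', C', X', Y', Z'] \<longleftrightarrow>
      [A, B, C, X, Y, Z] = [A', B', C', X', Y', Z']" for A B C X Y Z A' B' C' X' Y' Z'
  proof
    assume eq: "place ?V [A, B, C, X, Y, Z] = place ?V [A', B', C', X', Y', Z']"
    from fun_cong[OF eq, of a] fun_cong[OF eq, of b] fun_cong[OF eq, of c] fun_cong[OF eq, of x]
      fun_cong[OF eq, of y] fun_cong[OF eq, of z]
    show "[A, B, C, X, Y, Z] = [A', B', C', X', Y', Z']" unfolding place by (simp add: dist)
  qed simp
  have f_eq: "f s = f t \<longleftrightarrow> s = t \<or> s = - t" for s t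
  proof -
    have "f s = f t \<longleftrightarrow> T s = T t"
      unfolding f_def T_def tents_def by (rule place_eq)
    then show ?thesis by (auto simp: T_def tents_eq_iff vec_eq_iff forall_3)
  qed
  have f_scale: "f (r *\<^sub>R s) v = r * f s v" if "0 < r" for r s v
  proof -
    have "tent (r * u) (- (r * v)) (r * w) = r * tent u (- v) w" for u v w
      using tent_scale[OF that, of u "- v" w] by simp
    then show ?thesis using that by (simp add: f_def T_def tents_def place tent_scale)
  qed
  have f_nonneg: "0 \<le> f s v" for s v
    by (simp add: f_def T_def tents_def place tent_nonneg)
  have if_cont: "continuous_on X (\<lambda>s. if P then g s else h s)"
    if "continuous_on X g" "continuous_on X h" for X P and g h :: "real^3 \<Rightarrow> real"
    using that by (cases P) simp_all
  have f_cont: "continuous_on X (\<lambda>s. f s v)" for X v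
    unfolding f_def T_def tents_def place tent_def
    by (intro if_cont continuous_intros) simp_all
  have f_supp: "supp (f s) \<subseteq> set ?V" for s
    by (auto simp: f_def T_def tents_def place split: if_splits)
  define N where "N s = sum (f s) (set ?V)" for s
  have sum6: "sum g (set ?V) = g a + g b + g c + g x + g y + g z" for g :: "'v \<Rightarrow> real"
    using dist by (simp add: add.assoc)
  have facet: "\<exists>t\<in>set (rp2 a b c x y z). supp (f s) \<subseteq> set t" and N_pos: "0 < N s" if "s \<noteq> 0" for s
  proof -
    obtain p q r where pqr: "0 \<le> p" "0 \<le> q" "0 \<le> r" "p + q + r = 0 \<longrightarrow> s $ 1 = 0 \<and> s $ 2 = 0 \<and> s $ 3 = 0"
      and Ts: "T s \<in> {[p, q, r, 0, 0, 0], [p, 0, 0, 0, q, r], [0, 0, r, p, q, 0], [0, q, 0, p, 0, r],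
      [p, 0, r, q, 0, 0], [p, 0, 0, q, 0, r], [r, p, 0, 0, q, 0], [0, p, 0, r, q, 0],
      [0, r, p, 0, 0, q], [0, 0, p, 0, r, q]}"
      using tents_cases[of "s $ 1" "s $ 2" "s $ 3"] unfolding T_def by blast
    have "p + q + r \<noteq> 0" using pqr(4) that by (auto simp: vec_eq_iff forall_3)
    moreover have "N s = p + q + r"
      using Ts unfolding insert_iff empty_iff
      by (elim disjE; simp only: N_def sum6 f_def place; simp add: dist)
    ultimately show "0 < N s" using pqr(1-3) by linarith
    have sup: "\<exists>t\<in>set (rp2 a b c x y z). supp (f s) \<subseteq> set t"
      if "t \<in> set (rp2 a b c x y z)" "T s = rs" "\<And>v. v \<notin> set t \<Longrightarrow> place ?V rs v = 0" for t rs
      using that by (intro bexI[of _ t]) (auto simp: f_def)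
    from Ts show "\<exists>t\<in>set (rp2 a b c x y z). supp (f s) \<subseteq> set t"
      unfolding insert_iff empty_iff
      apply (elim disjE)
      subgoal by (rule sup[of "[a, b, c]"], simp add: rp2_def pinched_rp2_def, assumption, simp add: place)
      subgoal by (rule sup[of "[a, y, z]"], simp add: rp2_def pinched_rp2_def, assumption, simp add: place)
      subgoal by (rule sup[of "[x, y, c]"], simp add: rp2_def pinched_rp2_def, assumption, simp add: place)
      subgoal by (rule sup[of "[x, b, z]"], simp add: rp2_def pinched_rp2_def, assumption, simp add: place)
      subgoal by (rule sup[of "[a, x, c]"], simp add: rp2_def pinched_rp2_def, assumption, simp add: place)
      subgoal by (rule sup[of "[a, x, z]"], simp add: rp2_def pinched_rp2_def, assumption, simp add: place)
      subgoal by (rule sup[of "[b, y, a]"], simp add: rp2_def pinched_rp2_def, assumption, simp add: place)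
      subgoal by (rule sup[of "[b, y, x]"], simp add: rp2_def pinched_rp2_def, assumption, simp add: place)
      subgoal by (rule sup[of "[c, z, b]"], simp add: rp2_def pinched_rp2_def, assumption, simp add: place)
      subgoal by (rule sup[of "[c, z, y]"], simp add: rp2_def pinched_rp2_def, assumption, simp add: place)
      by simp
  qed
  define q where "q s = (\<lambda>v. f s v / N s)" for s
  note K = finite_simplicial_complex_complex_of[of "rp2 a b c x y z"]
  have q_in: "q s \<in> underlying_space ?K" if "s \<noteq> 0" for s
  proof (rule underlying_spaceI[OF K, where W = "set ?V"])
    have supp: "supp (q s) = supp (f s)" using N_pos[OF that] by (auto simp: q_def)
    have sum: "sum (q s) (set ?V) = 1"
      using N_pos[OF that] by (simp only: q_def sum_divide_distrib[symmetric] N_def[symmetric]) simp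
    then show "sum (q s) (set ?V) = 1" .
    show "supp (q s) \<subseteq> set ?V" unfolding supp by (rule f_supp)
    have "supp (q s) \<noteq> {}"
    proof
      assume "supp (q s) = {}"
      then have "\<And>v. q s v = 0" by auto
      then show False using sum by simp
    qed
    then show "supp (q s) \<in> ?K" using facet[OF that] unfolding supp complex_of_def by blast
    show "0 \<le> q s v" for v using f_nonneg N_pos[OF that] by (simp add: q_def less_imp_le)
  qed simp
  have q_eq: "q s = q t \<longleftrightarrow> s = t \<or> s = - t" if "norm s = 1" "norm t = 1" for s t
  proof
    assume eq: "q s = q t"
    have "s \<noteq> 0" "t \<noteq> 0" using that by auto
    then have pos: "0 < N s" "0 < N t" by (simp_all add: N_pos)
    \<comment> \<open>Equal images have proportional values under \<open>f\<close>; homogeneity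
      moves the factor into the argument, and comparing norms of unit vectors shows that it is
      1.\<close>
    have "f s v = f ((N s / N t) *\<^sub>R t) v" for v
      using fun_cong[OF eq, of v] pos by (simp add: f_scale q_def field_simps)
    then have "f s = f ((N s / N t) *\<^sub>R t)" by (rule ext)
    then have s: "s = (N s / N t) *\<^sub>R t \<or> s = - ((N s / N t) *\<^sub>R t)" by (simp add: f_eq)
    then have "norm s = N s / N t * norm t" using pos by (metis abs_of_pos divide_pos_pos norm_minus_cancel norm_scaleR)
    then show "s = t \<or> s = - t" using s that by simp
  next
    assume "s = t \<or> s = - t"
    then have "f s = f t" by (simp add: f_eq)
    then show "q s = q t" by (simp add: q_def N_def)
  qed
  have onto: "\<exists>s. norm s = 1 \<and> q s = g" if "g \<in> underlying_space ?K" for g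
  proof -
    have g: "\<And>v. 0 \<le> g v" "supp g \<in> ?K" "sum g (supp g) = 1"
      using that by (auto simp: underlying_space_iff[OF K])
    obtain t where t: "t \<in> set (rp2 a b c x y z)" "supp g \<subseteq> set t" using g(2) by (auto simp: complex_of_def)
    have "\<exists>s. f s = g"
    proof -
      have zero: "\<And>v. v \<notin> set t \<Longrightarrow> g v = 0" using t(2) by auto
      have wit: "\<exists>s. f s = g" if "tents u v w = rs" "place ?V rs = g" for u v w rs
        using that by (intro exI[of _ "vector [u, v, w]"]) (simp add: f_def T_def)
      \<comment> \<open>The coordinates of \<open>g\<close> at the vertices of the facet serve as
        the cone parameters. The third and fourth facet of \<open>rp2\<close> correspond to the
        fourth and third cone, in this order.\<close>
      from t(1) zero show ?thesis
        unfolding rp2_def pinched_rp2_def list.set insert_iff empty_iff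
        apply (elim disjE)
        subgoal by (rule wit[OF tents_cones(1)[OF g(1)[of a] g(1)[of b] g(1)[of c]]], rule ext) (auto simp: place dist)
        subgoal by (rule wit[OF tents_cones(2)[OF g(1)[of a] g(1)[of y] g(1)[of z]]], rule ext) (auto simp: place dist)
        subgoal by (rule wit[OF tents_cones(4)[OF g(1)[of x] g(1)[of b] g(1)[of z]]], rule ext) (auto simp: place dist)
        subgoal by (rule wit[OF tents_cones(3)[OF g(1)[of x] g(1)[of y] g(1)[of c]]], rule ext) (auto simp: place dist)
        subgoal by (rule wit[OF tents_cones(5)[OF g(1)[of a] g(1)[of x] g(1)[of c]]], rule ext) (auto simp: place dist)
        subgoal by (rule wit[OF tents_cones(6)[OF g(1)[of a] g(1)[of x] g(1)[of z]]], rule ext) (auto simp: place dist)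
        subgoal by (rule wit[OF tents_cones(7)[OF g(1)[of b] g(1)[of y] g(1)[of a]]], rule ext) (auto simp: place dist)
        subgoal by (rule wit[OF tents_cones(8)[OF g(1)[of b] g(1)[of y] g(1)[of x]]], rule ext) (auto simp: place dist)
        subgoal by (rule wit[OF tents_cones(9)[OF g(1)[of c] g(1)[of z] g(1)[of b]]], rule ext) (auto simp: place dist)
        subgoal by (rule wit[OF tents_cones(10)[OF g(1)[of c] g(1)[of z] g(1)[of y]]], rule ext) (auto simp: place dist)
        by simp
    qed
    then obtain s where s: "f s = g" by blast
    have "supp g \<subseteq> set ?V" using f_supp[of s] s by simp
    then have "N s = 1" using g(3) sum_eq_sum_supp[of "set ?V" g] by (simp add: N_def s)
    have "s \<noteq> 0"
    proof
      assume "s = 0"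
      then have "f s v = 0" for v by (simp add: f_def T_def tents_def place tent_def)
      then show False using \<open>N s = 1\<close> by (simp add: N_def)
    qed
    let ?s = "(1 / norm s) *\<^sub>R s"
    have fs: "f ?s v = g v / norm s" for v using \<open>s \<noteq> 0\<close> by (simp add: f_scale s)
    have "N ?s = N s / norm s" unfolding N_def sum_divide_distrib s by (rule sum.cong[OF refl fs])
    then have "q ?s v = g v" for v using fs \<open>s \<noteq> 0\<close> \<open>N s = 1\<close> by (simp add: q_def)
    then have "q ?s = g" by (rule ext)
    moreover have "norm ?s = 1" using \<open>s \<noteq> 0\<close> by simp
    ultimately show ?thesis by blast
  qed
  have img: "q ` sphere 0 1 = underlying_space ?K"
  proof (intro equalityI subsetI)
    fix g assume "g \<in> q ` sphere 0 1"
    then obtain s where s: "norm s = 1" "g = q s" by auto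
    then have "s \<noteq> 0" by auto
    then show "g \<in> underlying_space ?K" unfolding s(2) by (rule q_in)
  next
    fix g assume "g \<in> underlying_space ?K"
    then obtain s where "norm s = 1" "q s = g" using onto by blast
    then show "g \<in> q ` sphere 0 1" by (intro image_eqI[of _ _ s]) simp_all
  qed
  have "continuous_on (sphere 0 1) q"
    unfolding q_def N_def
  proof (intro continuous_on_coordinatewise_then_product continuous_on_divide continuous_on_sum f_cont ballI)
    fix s :: "real^3" assume "s \<in> sphere 0 1"
    then have "s \<noteq> 0" by auto
    then show "sum (f s) (set ?V) \<noteq> 0" using N_pos[of s] unfolding N_def by linarith
  qed
  then have cont: "continuous_map (top_of_set (sphere 0 1)) (top_of_set (underlying_space ?K)) q"
    using img by (auto simp: continuous_map_in_subtopology)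
  have "closed_map (top_of_set (sphere 0 1)) (top_of_set (underlying_space ?K)) q"
    by (rule continuous_imp_closed_map_gen[OF _ _ cont])
      (auto simp: compact_space_subtopology intro!: Hausdorff_imp_kc_space Hausdorff_space_subtopology)
  with cont have "quotient_map (top_of_set (sphere 0 1)) (top_of_set (underlying_space ?K)) q"
    by (rule continuous_closed_imp_quotient_map) (simp add: img)
  then show ?thesis unfolding projective_plane_def using q_eq by (intro exI[of _ q]) simp
qed

section \<open>Surfaces built by surgery on facets\<close>

definition flip_facets :: "'v list \<Rightarrow> 'v list \<Rightarrow> 'v list list \<Rightarrow> 'v list list" where
  "flip_facets A B L =
     filter (\<lambda>T. \<not> set A \<subseteq> set T) L @ map (\<lambda>a. filter (\<lambda>v. v \<noteq> a) (A @ B)) A"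

text \<open>An executable criterion for \<open>flippable\<close>: membership in the complex is
  tested on facets, and among the faces of the join that miss a vertex of \<open>B\<close> it
  suffices to test the largest ones.\<close>

definition flip_ok :: "'v list \<Rightarrow> 'v list \<Rightarrow> 'v list list \<Rightarrow> bool" where
  "flip_ok A B L \<longleftrightarrow> A \<noteq> [] \<and> B \<noteq> [] \<and> (\<forall>v\<in>set A. v \<notin> set B) \<and>
     (\<forall>T\<in>set L. set A \<subseteq> set T \<longrightarrow> set T \<subseteq> set (A @ B)) \<and> (\<forall>T\<in>set L. \<not> set B \<subseteq> set T) \<and>
     (\<forall>b\<in>set B. \<exists>T\<in>set L. set (filter (\<lambda>v. v \<noteq> b) (A @ B)) \<subseteq> set T)"

lemma flippable_complex_of:
  assumes "flip_ok A B L"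
  shows "flippable (set A) (set B) (complex_of L)"
  unfolding flippable_def
proof (intro conjI ballI allI impI)
  show "set A \<noteq> {}" "set B \<noteq> {}" "set A \<inter> set B = {}" using assms by (auto simp: flip_ok_def)
  show "\<sigma> \<subseteq> set A \<union> set B" if "\<sigma> \<in> complex_of L" "set A \<subseteq> \<sigma>" for \<sigma>
  proof -
    obtain T where "T \<in> set L" "\<sigma> \<subseteq> set T" using \<open>\<sigma> \<in> complex_of L\<close> by (auto simp: complex_of_def)
    moreover from this have "set T \<subseteq> set (A @ B)"
      using assms \<open>set A \<subseteq> \<sigma>\<close> unfolding flip_ok_def by (meson subset_trans)
    ultimately show ?thesis by auto
  qed
  show "set B \<notin> complex_of L" using assms by (auto simp: flip_ok_def complex_of_def)
  fix \<sigma> assume s: "\<sigma> \<noteq> {} \<and> \<sigma> \<subseteq> set A \<union> set B \<and> \<not> set B \<subseteq> \<sigma>"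
  then obtain b where "b \<in> set B" "b \<notin> \<sigma>" by blast
  then obtain T where "T \<in> set L" "set (filter (\<lambda>v. v \<noteq> b) (A @ B)) \<subseteq> set T"
    using assms unfolding flip_ok_def by meson
  moreover have "\<sigma> \<subseteq> set (filter (\<lambda>v. v \<noteq> b) (A @ B))" using s \<open>b \<notin> \<sigma>\<close> by auto
  ultimately show "\<sigma> \<in> complex_of L" using s unfolding complex_of_def by blast
qed simp_all

lemma complex_of_flip_facets:
  assumes "flip_ok A B L"
  shows "complex_of (flip_facets A B L) = bistellar (set A) (set B) (complex_of L)"
proof (intro equalityI subsetI)
  fix \<sigma> assume "\<sigma> \<in> complex_of (flip_facets A B L)"
  then obtain T where T: "T \<in> set (flip_facets A B L)" "\<sigma> \<noteq> {}" "\<sigma> \<subseteq> set T"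
    by (auto simp: complex_of_def)
  from T(1) consider "T \<in> set L" "\<not> set A \<subseteq> set T"
    | a where "a \<in> set A" "T = filter (\<lambda>v. v \<noteq> a) (A @ B)"
    by (auto simp: flip_facets_def)
  then show "\<sigma> \<in> bistellar (set A) (set B) (complex_of L)"
  proof cases
    case 1
    then show ?thesis using T by (auto simp: bistellar_def complex_of_def)
  next
    case 2
    then have "\<sigma> \<subseteq> set A \<union> set B" "\<not> set A \<subseteq> \<sigma>" using T by auto
    then show ?thesis using T by (simp add: bistellar_def)
  qed
next
  fix \<sigma> assume "\<sigma> \<in> bistellar (set A) (set B) (complex_of L)"
  then have s: "\<not> set A \<subseteq> \<sigma>" "\<sigma> \<noteq> {}" "\<sigma> \<in> complex_of L \<or> \<sigma> \<subseteq> set A \<union> set B"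
    by (auto simp: bistellar_def complex_of_def)
  then obtain a where a: "a \<in> set A" "a \<notin> \<sigma>" by blast
  have in_AB: "\<sigma> \<in> complex_of (flip_facets A B L)" if "\<sigma> \<subseteq> set A \<union> set B"
  proof -
    have "\<sigma> \<subseteq> set (filter (\<lambda>v. v \<noteq> a) (A @ B))" using that a by auto
    moreover have "filter (\<lambda>v. v \<noteq> a) (A @ B) \<in> set (flip_facets A B L)"
      using a by (simp add: flip_facets_def)
    ultimately show ?thesis using s(2) unfolding complex_of_def by blast
  qed
  show "\<sigma> \<in> complex_of (flip_facets A B L)"
  proof (cases "\<sigma> \<subseteq> set A \<union> set B")
    case False
    then obtain T where T: "T \<in> set L" "\<sigma> \<subseteq> set T" using s by (auto simp: complex_of_def)
    have "\<not> set A \<subseteq> set T"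
    proof
      assume "set A \<subseteq> set T"
      then have "set T \<subseteq> set (A @ B)" using assms T(1) unfolding flip_ok_def by meson
      then show False using False T(2) by auto
    qed
    then have "T \<in> set (flip_facets A B L)" using T(1) by (simp add: flip_facets_def)
    then show ?thesis using T(2) s(2) unfolding complex_of_def by blast
  qed (rule in_AB)
qed

definition crosscap_facets :: "'v \<Rightarrow> 'v \<Rightarrow> 'v \<Rightarrow> 'v \<Rightarrow> 'v \<Rightarrow> 'v \<Rightarrow> 'v list list \<Rightarrow> 'v list list" where
  "crosscap_facets a b c x y z L = filter (\<lambda>T. \<not> set [a, b, c] \<subseteq> set T) L @ pinched_rp2 a b c x y z"

text \<open>Freshness of \<open>x\<close>, \<open>y\<close>, \<open>z\<close> makes the two summands
  meet only inside the triangle. Because the complex is generated by its facets, the last clause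
  guarantees that deleting the triangle from the list does not also delete one of its edges.\<close>

definition crosscap_ok :: "'v \<Rightarrow> 'v \<Rightarrow> 'v \<Rightarrow> 'v \<Rightarrow> 'v \<Rightarrow> 'v \<Rightarrow> 'v list list \<Rightarrow> bool" where
  "crosscap_ok a b c x y z L \<longleftrightarrow> distinct [a, b, c, x, y, z] \<and>
     (\<forall>T\<in>set L. x \<notin> set T \<and> y \<notin> set T \<and> z \<notin> set T) \<and> (\<exists>T\<in>set L. set [a, b, c] \<subseteq> set T) \<and>
     (\<forall>T\<in>set L. set [a, b, c] \<subseteq> set T \<longrightarrow> set T \<subseteq> set [a, b, c]) \<and>
     (\<forall>e\<in>set [[a, b], [b, c], [a, c]]. \<exists>T\<in>set L. \<not> set [a, b, c] \<subseteq> set T \<and> set e \<subseteq> set T)"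

lemma complex_of_crosscap_facets:
  assumes ok: "crosscap_ok a b c x y z L"
  shows "complex_of (crosscap_facets a b c x y z L) =
    complex_of L \<union> complex_of (rp2 a b c x y z) - {{a, b, c}}"
proof -
  let ?L = "filter (\<lambda>T. \<not> set [a, b, c] \<subseteq> set T) L"
  have d: "distinct [a, b, c, x, y, z]" using ok by (simp add: crosscap_ok_def)
  have app: "complex_of (L\<^sub>1 @ L\<^sub>2) = complex_of L\<^sub>1 \<union> complex_of L\<^sub>2" for L\<^sub>1 L\<^sub>2 :: "'a list list"
    by (auto simp: complex_of_def)
  have "complex_of ?L = complex_of L - {{a, b, c}}"
  proof (intro equalityI subsetI)
    fix \<sigma> assume "\<sigma> \<in> complex_of L - {{a, b, c}}"
    then obtain T where T: "T \<in> set L" "\<sigma> \<noteq> {}" "\<sigma> \<subseteq> set T" "\<sigma> \<noteq> {a, b, c}"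
      by (auto simp: complex_of_def)
    show "\<sigma> \<in> complex_of ?L"
    proof (cases "set [a, b, c] \<subseteq> set T")
      case True
      then have "\<sigma> \<subseteq> {a, b, c}" using ok T(1,3) unfolding crosscap_ok_def by fastforce
      then have "\<sigma> \<subseteq> {a, b} \<or> \<sigma> \<subseteq> {b, c} \<or> \<sigma> \<subseteq> {a, c}" using T(4) by blast
      then have "\<exists>e\<in>set [[a, b], [b, c], [a, c]]. \<sigma> \<subseteq> set e" by simp
      then obtain e where "e \<in> set [[a, b], [b, c], [a, c]]" "\<sigma> \<subseteq> set e" by blast
      moreover from this obtain T' where "T' \<in> set L" "\<not> set [a, b, c] \<subseteq> set T'" "set e \<subseteq> set T'"
        using ok unfolding crosscap_ok_def by meson
      ultimately have "T' \<in> set ?L" "\<sigma> \<subseteq> set T'" by auto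
      then show ?thesis using T(2) unfolding complex_of_def by blast
    next
      case False
      then show ?thesis using T by (auto simp: complex_of_def)
    qed
  qed (auto simp: complex_of_def)
  moreover have "complex_of (pinched_rp2 a b c x y z) = complex_of (rp2 a b c x y z) - {{a, b, c}}"
  proof (intro equalityI subsetI)
    fix \<sigma> assume "\<sigma> \<in> complex_of (pinched_rp2 a b c x y z)"
    moreover have "\<forall>T\<in>set (pinched_rp2 a b c x y z). \<not> {a, b, c} \<subseteq> set T"
      using d by (auto simp: pinched_rp2_def)
    ultimately show "\<sigma> \<in> complex_of (rp2 a b c x y z) - {{a, b, c}}"
      by (auto simp: complex_of_def rp2_def)
  next
    fix \<sigma> assume s: "\<sigma> \<in> complex_of (rp2 a b c x y z) - {{a, b, c}}"
    show "\<sigma> \<in> complex_of (pinched_rp2 a b c x y z)"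
    proof (cases "\<sigma> \<subseteq> {a, b, c}")
      case True
      then have "\<sigma> \<subseteq> {a, b} \<or> \<sigma> \<subseteq> {b, c} \<or> \<sigma> \<subseteq> {a, c}" using s by blast
      then have "\<sigma> \<subseteq> set [b, y, a] \<or> \<sigma> \<subseteq> set [c, z, b] \<or> \<sigma> \<subseteq> set [a, x, c]" by auto
      moreover have "{[b, y, a], [c, z, b], [a, x, c]} \<subseteq> set (pinched_rp2 a b c x y z)"
        by (simp add: pinched_rp2_def)
      ultimately show ?thesis using s unfolding complex_of_def by blast
    next
      case False
      then show ?thesis using s by (auto simp: complex_of_def rp2_def)
    qed
  qed
  ultimately show ?thesis unfolding crosscap_facets_def app by blast
qed

lemma nonorientable_surface_crosscap:
  fixes L :: "nat list list"
  assumes S: "nonorientable_surface h (top_of_set (underlying_space (complex_of L)))"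
    and ok: "crosscap_ok a b c x y z L"
  shows "nonorientable_surface (Suc h) (top_of_set (underlying_space (complex_of (crosscap_facets a b c x y z L))))"
proof (rule nonorientable_surface.step[OF S])
  have d: "distinct [a, b, c, x, y, z]" using ok by (simp add: crosscap_ok_def)
  then show "projective_plane (top_of_set (underlying_space (complex_of (rp2 a b c x y z))))"
    by (rule projective_plane_rp2)
  show "connected_sum (top_of_set (underlying_space (complex_of L)))
      (top_of_set (underlying_space (complex_of (rp2 a b c x y z))))
      (top_of_set (underlying_space (complex_of (crosscap_facets a b c x y z L))))"
    unfolding complex_of_crosscap_facets[OF ok]
  proof (rule connected_sum_complex[OF _ _ _ refl])
    show "finite_simplicial_complex (complex_of L)" "finite_simplicial_complex (complex_of (rp2 a b c x y z))"
      by (rule finite_simplicial_complex_complex_of)+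
    show "distinct [a, b, c]" using d by simp
    show "{a, b, c} \<in> complex_of L" using ok by (auto simp: crosscap_ok_def complex_of_def)
    show "{a, b, c} \<in> complex_of (rp2 a b c x y z)" by (simp add: complex_of_def rp2_def)
    fix \<sigma>
    show "\<sigma> = {a, b, c}" if "\<sigma> \<in> complex_of L" "{a, b, c} \<subseteq> \<sigma>"
    proof -
      obtain T where T: "T \<in> set L" "\<sigma> \<subseteq> set T" using \<open>\<sigma> \<in> complex_of L\<close> by (auto simp: complex_of_def)
      then have "set [a, b, c] \<subseteq> set T" using that by auto
      then have "set T \<subseteq> set [a, b, c]" using ok T(1) unfolding crosscap_ok_def by meson
      then show ?thesis using T that by auto
    qed
    show "\<sigma> = {a, b, c}" if "\<sigma> \<in> complex_of (rp2 a b c x y z)" "{a, b, c} \<subseteq> \<sigma>"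
    proof -
      have "\<forall>T\<in>set (pinched_rp2 a b c x y z). \<not> {a, b, c} \<subseteq> set T"
        using d by (auto simp: pinched_rp2_def)
      then have "\<sigma> \<subseteq> {a, b, c}" using that by (auto simp: complex_of_def rp2_def)
      then show ?thesis using that by blast
    qed
    show "\<sigma> \<subseteq> {a, b, c}" if "\<sigma> \<in> complex_of L" "\<sigma> \<in> complex_of (rp2 a b c x y z)"
    proof -
      obtain T where "T \<in> set L" "\<sigma> \<subseteq> set T" using \<open>\<sigma> \<in> complex_of L\<close> by (auto simp: complex_of_def)
      then have "x \<notin> \<sigma>" "y \<notin> \<sigma>" "z \<notin> \<sigma>" using ok by (auto simp: crosscap_ok_def)
      moreover have "\<sigma> \<subseteq> {a, b, c, x, y, z}"
        using that(2) by (auto simp: complex_of_def rp2_def pinched_rp2_def)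
      ultimately show ?thesis by blast
    qed
  qed
qed

section \<open>Sequences of surgeries and the witness\<close>

datatype 'v surgery = Flip "'v list" "'v list" | Crosscap 'v 'v 'v 'v 'v 'v

text \<open>The genus is carried along with the facets, and an inadmissible step yields
  \<open>None\<close>, so that a single evaluation certifies the whole sequence together with its
  result.\<close>

fun perform :: "'v surgery list \<Rightarrow> nat \<times> 'v list list \<Rightarrow> (nat \<times> 'v list list) option" where
  "perform [] (h, L) = Some (h, L)"
| "perform (Flip A B # ops) (h, L) =
     (if flip_ok A B L then perform ops (h, flip_facets A B L) else None)"
| "perform (Crosscap a b c x y z # ops) (h, L) =
     (if crosscap_ok a b c x y z L then perform ops (Suc h, crosscap_facets a b c x y z L) else None)"

lemma nonorientable_surface_perform:
  fixes ops :: "nat surgery list"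
  assumes "nonorientable_surface h (top_of_set (underlying_space (complex_of L)))"
    and "perform ops (h, L) = Some (h', L')"
  shows "nonorientable_surface h' (top_of_set (underlying_space (complex_of L')))"
  using assms
proof (induction ops "(h, L)" arbitrary: h L rule: perform.induct)
  case (2 A B ops h L)
  then have ok: "flip_ok A B L" by (auto split: if_splits)
  have "nonorientable_surface h (top_of_set (underlying_space (complex_of (flip_facets A B L))))"
    using homeomorphic_bistellar[OF finite_simplicial_complex_complex_of flippable_complex_of[OF ok]] 2(2)
    unfolding complex_of_flip_facets[OF ok] by (rule nonorientable_surface_homeomorphic[rotated])
  then show ?case using 2(1)[OF ok] 2(3) ok by simp
next
  case (3 a b c x y z ops h L)
  then have ok: "crosscap_ok a b c x y z L" by (auto split: if_splits)
  show ?case using 3(1)[OF ok nonorientable_surface_crosscap[OF 3(2) ok]] 3(3) ok by simp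
qed simp

text \<open>The triangles, and the vertices in each of them, stand in the order in which the last
  surgery leaves them, so that \<open>perform_facets\<close> is a literal equality of lists.\<close>

definition facets :: "nat list list" where
  "facets = [[6,1,9], [8,9,1], [8,9,0], [2,1,4], [1,4,8], [2,4,9], [2,7,8], [0,2,6], [1,5,6], [0,5,9],
     [1,5,7], [3,4,6], [0,3,5], [7,1,3], [8,0,7], [5,6,8], [2,6,8], [9,2,5], [7,2,5], [4,7,9],
     [7,3,9], [3,6,9], [5,3,8], [4,3,8], [1,2,3], [0,2,3], [7,0,4], [6,0,4]]"

lemma perform_facets:
  "perform
    [Crosscap 4 1 8 6 0 9, Flip [1,4] [0,10], Flip [4,8] [2,6], Flip [1,10] [0,2],
     Flip [2,7] [1,4], Flip [1,7] [4,8], Flip [7] [4,8,10], Crosscap 4 6 9 7 3 11,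
     Flip [4,6] [2,3], Flip [4,9] [0,7], Flip [7,11] [4,6], Flip [6,11] [4,9], Flip [3,6] [2,7],
     Flip [3,7] [2,9], Flip [11] [3,4,9], Flip [3] [2,4,9], Crosscap 1 2 0 3 11 5,
     Flip [0,2] [5,10], Flip [2,10] [5,8], Flip [8,10] [4,5], Flip [3,11] [0,2],
     Flip [0,1] [3,6], Flip [10] [0,4,5], Flip [2,11] [0,1], Flip [2,6] [7,8], Flip [0,3] [2,6],
     Flip [0,4] [5,7], Flip [11] [0,1,5], Flip [1,3] [5,6], Flip [3] [2,5,6],
     Crosscap 7 0 5 10 3 11, Flip [0,5] [1,11], Flip [3,10] [0,5], Flip [0,7] [3,9],
     Flip [5,10] [0,7], Flip [10] [0,7,11], Flip [5,7] [0,4], Flip [3,11] [5,7],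
     Flip [0,3] [5,9], Flip [0,11] [1,7], Flip [11] [1,5,7], Flip [3] [5,7,9],
     Crosscap 4 7 6 10 3 11, Flip [4,7] [0,3], Flip [4,6] [9,10], Flip [10,11] [4,7],
     Flip [7,11] [4,6], Flip [11] [3,4,6], Flip [0,4] [3,5], Flip [0,7] [1,3], Flip [6,8] [0,7],
     Flip [2,5] [6,8], Flip [7,9] [2,5], Flip [4,10] [7,9], Flip [7,10] [3,9],
     Flip [10] [3,6,9], Flip [4,5] [3,8], Flip [0,1] [2,3], Flip [6,7] [0,4]]
    (1, rp2 4 1 8 2 10 7) = Some (6, facets)"
  unfolding facets_def by code_simp

lemma nonorientable_surface_facets:
  "nonorientable_surface 6 (top_of_set (underlying_space (complex_of facets)))"
  by (rule nonorientable_surface_perform[OF _ perform_facets])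
    (rule nonorientable_surface.one, rule projective_plane_rp2, simp)

section \<open>Immersions\<close>

definition det3 :: "real^3 \<Rightarrow> real^3 \<Rightarrow> real^3 \<Rightarrow> real" where
  "det3 A B C = A $ 1 * (B $ 2 * C $ 3 - B $ 3 * C $ 2) - A $ 2 * (B $ 1 * C $ 3 - B $ 3 * C $ 1)
     + A $ 3 * (B $ 1 * C $ 2 - B $ 2 * C $ 1)"

lemma det3_combination:
  assumes "\<alpha> *\<^sub>R A + \<beta> *\<^sub>R B = \<gamma> *\<^sub>R C + \<delta> *\<^sub>R D"
  shows "\<alpha> * det3 A P Q + \<beta> * det3 B P Q = \<gamma> * det3 C P Q + \<delta> * det3 D P Q"
proof -
  have "\<alpha> * det3 A P Q + \<beta> * det3 B P Q = det3 (\<alpha> *\<^sub>R A + \<beta> *\<^sub>R B) P Q"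
    by (simp add: det3_def algebra_simps)
  also have "\<dots> = \<gamma> * det3 C P Q + \<delta> * det3 D P Q"
    unfolding assms by (simp add: det3_def algebra_simps)
  finally show ?thesis .
qed

lemma det3_independent:
  assumes "\<alpha> *\<^sub>R A + \<beta> *\<^sub>R B = \<gamma> *\<^sub>R C" "det3 A B C \<noteq> 0"
  shows "\<alpha> = 0 \<and> \<beta> = 0 \<and> \<gamma> = 0"
proof -
  have *: "\<alpha> * det3 A P Q + \<beta> * det3 B P Q = \<gamma> * det3 C P Q" for P Q
    using det3_combination[of \<alpha> A \<beta> B \<gamma> C 0 C] assms(1) by simp
  have "\<alpha> * det3 A B C = 0" "\<beta> * det3 A B C = 0" "\<gamma> * det3 A B C = 0"
    using *[of B C] *[of A C] *[of A B] by (simp_all add: det3_def algebra_simps)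
  then show ?thesis using assms(2) by simp
qed

text \<open>
  Up to a scalar, the only linear relation among four vectors in general position has the
  determinants of triples as coefficients; the cones over \<open>A\<close>, \<open>B\<close> and over \<open>C\<close>, \<open>D\<close> meet
  outside the origin iff the signs of this relation are \<open>+ + - -\<close>.
\<close>

definition cones_cross :: "'a::linordered_idom \<Rightarrow> 'a \<Rightarrow> 'a \<Rightarrow> 'a \<Rightarrow> bool" where
  "cones_cross bcd acd abd abc \<longleftrightarrow> bcd = 0 \<or> acd = 0 \<or> abd = 0 \<or> abc = 0 \<or>
     bcd * acd < 0 \<and> bcd * abd < 0 \<and> 0 < bcd * abc"

text \<open>Applying \<open>det3\<close> with two of the four vectors in the other slots removes
  these two from the relation, so \<beta>, \<gamma>, \<delta> become \<alpha> times quotients of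
  determinants. Multiplying by the common denominator once more turns the quotients into products,
  and a positive \<alpha> would force the crossing pattern of signs.\<close>

lemma not_cones_cross:
  assumes eq: "\<alpha> *\<^sub>R A + \<beta> *\<^sub>R B = \<gamma> *\<^sub>R C + \<delta> *\<^sub>R D"
    and pos: "0 \<le> \<alpha>" "0 \<le> \<beta>" "0 \<le> \<gamma>" "0 \<le> \<delta>"
    and sep: "\<not> cones_cross (det3 B C D) (det3 A C D) (det3 A B D) (det3 A B C)"
  shows "\<alpha> = 0 \<and> \<beta> = 0 \<and> \<gamma> = 0 \<and> \<delta> = 0"
proof -
  let ?d = "det3 B C D"
  have d: "?d \<noteq> 0" "det3 A C D \<noteq> 0" "det3 A B D \<noteq> 0" "det3 A B C \<noteq> 0"
    and no: "\<not> (?d * det3 A C D < 0 \<and> ?d * det3 A B D < 0 \<and> 0 < ?d * det3 A B C)"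
    using sep by (auto simp: cones_cross_def)
  note * = det3_combination[OF eq]
  have b: "\<beta> * ?d = - \<alpha> * det3 A C D" using *[of C D] by (simp add: det3_def algebra_simps)
  have c: "\<gamma> * ?d = - \<alpha> * det3 A B D" using *[of B D] by (simp add: det3_def algebra_simps)
  have e: "\<delta> * ?d = \<alpha> * det3 A B C" using *[of B C] by (simp add: det3_def algebra_simps)
  have "\<alpha> = 0"
  proof (rule ccontr)
    assume "\<alpha> \<noteq> 0"
    then have a: "0 < \<alpha>" using pos by simp
    have sq: "0 \<le> \<beta> * (?d * ?d)" "0 \<le> \<gamma> * (?d * ?d)" "0 \<le> \<delta> * (?d * ?d)" using pos by simp_all
    have "\<beta> * (?d * ?d) = - \<alpha> * (?d * det3 A C D)" "\<gamma> * (?d * ?d) = - \<alpha> * (?d * det3 A B D)"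
      "\<delta> * (?d * ?d) = \<alpha> * (?d * det3 A B C)"
      unfolding mult.assoc[symmetric] b c e by (simp_all add: ac_simps)
    with sq a have "?d * det3 A C D \<le> 0" "?d * det3 A B D \<le> 0" "0 \<le> ?d * det3 A B C"
      by (simp_all add: mult_le_0_iff zero_le_mult_iff)
    then show False using no d by (simp add: less_le)
  qed
  then show ?thesis using b c e d by simp
qed

text \<open>Integer counterpart of \<open>det3\<close> for directions seen from the apex
  \<open>v\<close>: the test is evaluated on integers and carried over to the reals by
  \<open>of_int_det_points\<close>.\<close>

definition det_points :: "(nat \<Rightarrow> int \<times> int \<times> int) \<Rightarrow> nat \<Rightarrow> nat \<Rightarrow> nat \<Rightarrow> nat \<Rightarrow> int" where
  "det_points p v a b c = (case p v of (v1, v2, v3) \<Rightarrow> case p a of (a1, a2, a3) \<Rightarrow>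
     case p b of (b1, b2, b3) \<Rightarrow> case p c of (c1, c2, c3) \<Rightarrow>
       (a1 - v1) * ((b2 - v2) * (c3 - v3) - (b3 - v3) * (c2 - v2))
       - (a2 - v2) * ((b1 - v1) * (c3 - v3) - (b3 - v3) * (c1 - v1))
       + (a3 - v3) * ((b1 - v1) * (c2 - v2) - (b2 - v2) * (c1 - v1)))"

definition realize :: "(nat \<Rightarrow> int \<times> int \<times> int) \<Rightarrow> nat \<Rightarrow> real^3" where
  "realize p v = (case p v of (x, y, z) \<Rightarrow> vector [of_int x, of_int y, of_int z])"

lemma of_int_det_points:
  "of_int (det_points p v a b c)
    = det3 (realize p a - realize p v) (realize p b - realize p v) (realize p c - realize p v)"
  by (simp add: det_points_def det3_def realize_def split: prod.split)

text \<open>A triangle at \<open>v\<close> enters through its opposite edge, and the condition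
  depends on how two such edges meet. If they coincide, any \<open>w\<close> with nonzero
  determinant certifies that the two directions are independent; this includes a triangle compared
  with itself. If they share one end, the three directions must be independent; if they are
  disjoint, the two cones may meet only at the apex.\<close>

definition link_edges_ok :: "(nat \<Rightarrow> int \<times> int \<times> int) \<Rightarrow> nat list \<Rightarrow> nat \<Rightarrow> nat list \<Rightarrow> nat list \<Rightarrow> bool" where
  "link_edges_ok p vs v e f \<longleftrightarrow> (case (e, f) of ([a, b], [c, d]) \<Rightarrow>
       (if c = a \<or> c = b then
          if d = a \<or> d = b then \<exists>w\<in>set vs. det_points p v a b w \<noteq> 0
          else det_points p v a b d \<noteq> 0
        else if d = a \<or> d = b then det_points p v a b c \<noteq> 0
        else \<not> cones_cross (det_points p v b c d) (det_points p v a c d)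
               (det_points p v a b d) (det_points p v a b c))
     | _ \<Rightarrow> False)"

definition immersed :: "(nat \<Rightarrow> int \<times> int \<times> int) \<Rightarrow> nat list \<Rightarrow> nat list list \<Rightarrow> bool" where
  "immersed p vs L \<longleftrightarrow> (\<forall>T\<in>set L. distinct T) \<and>
     (\<forall>T\<in>set L. \<forall>T'\<in>set L. \<forall>v\<in>set T. v \<in> set T' \<longrightarrow>
        link_edges_ok p vs v (filter (\<lambda>u. u \<noteq> v) T) (filter (\<lambda>u. u \<noteq> v) T'))"

lemma simplexwise_linear_map_star:
  assumes x: "x \<in> underlying_space (complex_of L)" and "supp x \<subseteq> {v, a, b}" "distinct [v, a, b]"
  shows "simplexwise_linear_map (complex_of L) \<psi> x - \<psi> v = x a *\<^sub>R (\<psi> a - \<psi> v) + x b *\<^sub>R (\<psi> b - \<psi> v)"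
    and "x v = 1 - x a - x b"
proof -
  note K = finite_simplicial_complex_complex_of[of L]
  have xs: "supp x \<in> complex_of L" "sum x (supp x) = 1" using x by (auto simp: underlying_space_iff[OF K])
  have fin: "finite (vertices (complex_of L))" using K by (auto simp: finite_simplicial_complex_def)
  have "simplexwise_linear_map (complex_of L) \<psi> x = (\<Sum>u\<in>supp x. x u *\<^sub>R \<psi> u)"
    unfolding simplexwise_linear_map_def using fin xs(1) by (intro sum.mono_neutral_right) auto
  also have "\<dots> = (\<Sum>u\<in>{v, a, b}. x u *\<^sub>R \<psi> u)"
    using assms(2) by (intro sum.mono_neutral_left) auto
  also have "\<dots> = x v *\<^sub>R \<psi> v + x a *\<^sub>R \<psi> a + x b *\<^sub>R \<psi> b"
    using assms(3) by (simp add: add.assoc)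
  finally have phi: "simplexwise_linear_map (complex_of L) \<psi> x = x v *\<^sub>R \<psi> v + x a *\<^sub>R \<psi> a + x b *\<^sub>R \<psi> b" .
  have "sum x {v, a, b} = 1" using xs(2) sum_eq_sum_supp[of "{v, a, b}" x] assms(2) by simp
  then show xv: "x v = 1 - x a - x b" using assms(3) by simp
  show "simplexwise_linear_map (complex_of L) \<psi> x - \<psi> v = x a *\<^sub>R (\<psi> a - \<psi> v) + x b *\<^sub>R (\<psi> b - \<psi> v)"
    unfolding phi xv by (simp add: algebra_simps)
qed

lemma link_edges_ok_injective:
  assumes ok: "link_edges_ok p vs v [a, b] [c, d]"
    and d: "distinct [v, a, b]" "distinct [v, c, d]"
    and x: "x \<in> underlying_space (complex_of L)" "supp x \<subseteq> {v, a, b}"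
    and y: "y \<in> underlying_space (complex_of L)" "supp y \<subseteq> {v, c, d}"
    and eq: "simplexwise_linear_map (complex_of L) (realize p) x = simplexwise_linear_map (complex_of L) (realize p) y"
  shows "x = y"
proof -
  let ?D = "\<lambda>u. realize p u - realize p v"
  note K = finite_simplicial_complex_complex_of[of L]
  have pos: "0 \<le> x u" "0 \<le> y u" for u using x(1) y(1) by (auto simp: underlying_space_iff[OF K])
  note sx = simplexwise_linear_map_star[OF x d(1)] and sy = simplexwise_linear_map_star[OF y d(2)]
  have comb: "x a *\<^sub>R ?D a + x b *\<^sub>R ?D b = y c *\<^sub>R ?D c + y d *\<^sub>R ?D d"
    using sx(1)[of "realize p"] sy(1)[of "realize p"] eq by simp
  have det: "det_points p v i j k \<noteq> 0 \<Longrightarrow> det3 (?D i) (?D j) (?D k) \<noteq> 0" for i j k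
    by (simp flip: of_int_det_points)
  have zero: "u \<notin> {v, a, b} \<Longrightarrow> x u = 0" "u \<notin> {v, c, d} \<Longrightarrow> y u = 0" for u using x(2) y(2) by auto
  \<comment> \<open>Barycentric coordinates sum to 1, so agreement at the link vertices forces
    agreement at \<open>v\<close> as well.\<close>
  have conclude: "x = y" if "\<And>u. u \<in> {a, b, c, d} \<Longrightarrow> x u = y u"
  proof
    fix u
    have "x u = y u" if "u \<noteq> v"
      using \<open>\<And>u. u \<in> {a, b, c, d} \<Longrightarrow> x u = y u\<close>[of u] zero[of u] that
      by (cases "u \<in> {a, b, c, d}") auto
    moreover have "x v = y v"
    proof -
      have "sum x {v, a, b, c, d} = 1" "sum y {v, a, b, c, d} = 1"
        using x y sum_eq_sum_supp[of "{v, a, b, c, d}" x] sum_eq_sum_supp[of "{v, a, b, c, d}" y]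
        by (auto simp: underlying_space_iff[OF K])
      moreover have "sum x ({a, b, c, d} - {v}) = sum y ({a, b, c, d} - {v})"
        using that by (intro sum.cong) auto
      ultimately show ?thesis by (simp add: sum.insert_remove)
    qed
    ultimately show "x u = y u" by auto
  qed
  consider (same) w where "{c, d} = {a, b}" "det_points p v a b w \<noteq> 0"
    | (cd) "c = a \<or> c = b" "d \<notin> {a, b}" "det_points p v a b d \<noteq> 0"
    | (dc) "d = a \<or> d = b" "c \<notin> {a, b}" "det_points p v a b c \<noteq> 0"
    | (apart) "c \<notin> {a, b}" "d \<notin> {a, b}" "\<not> cones_cross (det_points p v b c d) (det_points p v a c d)
               (det_points p v a b d) (det_points p v a b c)"
    using ok d by (auto simp: link_edges_ok_def split: if_splits)
  then show ?thesis
  proof cases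
    case same
    have "y c *\<^sub>R ?D c + y d *\<^sub>R ?D d = y a *\<^sub>R ?D a + y b *\<^sub>R ?D b"
      using same(1) by (auto simp: doubleton_eq_iff)
    then have "x a *\<^sub>R ?D a + x b *\<^sub>R ?D b - (y a *\<^sub>R ?D a + y b *\<^sub>R ?D b) = 0 *\<^sub>R ?D w"
      using comb by (simp only: diff_self scaleR_zero_left)
    then have "(x a - y a) *\<^sub>R ?D a + (x b - y b) *\<^sub>R ?D b = 0 *\<^sub>R ?D w"
      by (simp only: scaleR_diff_left add_diff_add)
    from det3_independent[OF this det[OF same(2)]] have "x a = y a" "x b = y b" by simp_all
    moreover have "{a, b, c, d} = {a, b} \<union> {c, d}" by auto
    then have "{a, b, c, d} = {a, b}" unfolding same(1) by simp
    ultimately show ?thesis by (intro conclude) auto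
  next
    case cd
    \<comment> \<open>The term of the shared vertex is moved to the left, which leaves a relation
      among three independent directions.\<close>
    have "(x a - (if c = a then y c else 0)) *\<^sub>R ?D a + (x b - (if c = b then y c else 0)) *\<^sub>R ?D b = y d *\<^sub>R ?D d"
      using comb cd(1) d(1) by (auto simp: algebra_simps)
    from det3_independent[OF this det[OF cd(3)]]
    have "x a = (if c = a then y c else 0)" "x b = (if c = b then y c else 0)" "y d = 0" by simp_all
    then show ?thesis using cd d zero by (intro conclude) (auto split: if_splits)
  next
    case dc
    have "(x a - (if d = a then y d else 0)) *\<^sub>R ?D a + (x b - (if d = b then y d else 0)) *\<^sub>R ?D b = y c *\<^sub>R ?D c"
      using comb dc(1) d(1) by (auto simp: algebra_simps)
    from det3_independent[OF this det[OF dc(3)]]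
    have "x a = (if d = a then y d else 0)" "x b = (if d = b then y d else 0)" "y c = 0" by simp_all
    then show ?thesis using dc d zero by (intro conclude) (auto split: if_splits)
  next
    case apart
    have "\<not> cones_cross (det3 (?D b) (?D c) (?D d)) (det3 (?D a) (?D c) (?D d))
        (det3 (?D a) (?D b) (?D d)) (det3 (?D a) (?D b) (?D c))"
      using apart(3) unfolding cones_cross_def of_int_det_points[symmetric]
      by (simp flip: of_int_mult)
    from not_cones_cross[OF comb pos(1) pos(1) pos(2) pos(2) this]
    show ?thesis using apart d zero by (intro conclude) auto
  qed
qed

lemma polyhedral_realization_if_immersed:
  assumes imm: "immersed p vs L"
  shows "polyhedral_realization (complex_of L) (realize p)"
  unfolding polyhedral_realization_def locally_injective_on_def
proof
  note K = finite_simplicial_complex_complex_of[of L]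
  let ?X = "underlying_space (complex_of L)" and ?\<phi> = "simplexwise_linear_map (complex_of L) (realize p)"
  fix x\<^sub>0 assume x0: "x\<^sub>0 \<in> ?X"
  then have x0s: "supp x\<^sub>0 \<in> complex_of L" by (simp add: underlying_space_iff[OF K])
  then obtain v where v: "x\<^sub>0 v \<noteq> 0" by (auto simp: complex_of_def)
  \<comment> \<open>This is the open star of \<open>v\<close>. Any two of its points lie in
    triangles that contain \<open>v\<close>, so the pairwise test at \<open>v\<close> gives
    injectivity on the whole set.\<close>
  let ?U = "?X \<inter> {x. x v \<noteq> 0}"
  have "open {x :: nat \<Rightarrow> real. x v \<noteq> 0}"
    by (intro open_Collect_neq continuous_on_const) (rule continuous_on_product_coordinates)
  then have "openin (top_of_set ?X) ?U" by (rule openin_open_Int)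
  moreover have "inj_on ?\<phi> ?U"
  proof (rule inj_onI)
    fix x y assume x: "x \<in> ?U" and y: "y \<in> ?U" and eq: "?\<phi> x = ?\<phi> y"
    have star: "\<exists>T\<in>set L. v \<in> set T \<and> supp x \<subseteq> set T" if "x \<in> ?U" for x
    proof -
      have "supp x \<in> complex_of L" "v \<in> supp x" using that by (auto simp: underlying_space_iff[OF K])
      then show ?thesis unfolding complex_of_def by blast
    qed
    obtain T T' where T: "T \<in> set L" "v \<in> set T" "supp x \<subseteq> set T"
      and T': "T' \<in> set L" "v \<in> set T'" "supp y \<subseteq> set T'"
      using star[OF x] star[OF y] by blast
    have ok: "link_edges_ok p vs v (filter (\<lambda>u. u \<noteq> v) T) (filter (\<lambda>u. u \<noteq> v) T')"
      and dT: "distinct T" "distinct T'" using imm T(1,2) T'(1,2) unfolding immersed_def by blast+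
    then obtain a b c d where ab: "filter (\<lambda>u. u \<noteq> v) T = [a, b]" and cd: "filter (\<lambda>u. u \<noteq> v) T' = [c, d]"
      by (auto simp: link_edges_ok_def split: list.splits)
    have "set T = insert v (set [a, b])" "set T' = insert v (set [c, d])"
      unfolding ab[symmetric] cd[symmetric] using T T' by auto
    moreover have "distinct (v # [a, b])" "distinct (v # [c, d])"
      unfolding ab[symmetric] cd[symmetric] using dT by auto
    ultimately show "x = y"
      using x y T T' by (intro link_edges_ok_injective[OF ok[unfolded ab cd] _ _ _ _ _ _ eq]) auto
  qed
  ultimately show "\<exists>U. openin (top_of_set ?X) U \<and> x\<^sub>0 \<in> U \<and> inj_on ?\<phi> U"
    using x0 v by (intro exI[of _ ?U]) auto
qed

definition coords :: "nat \<Rightarrow> int \<times> int \<times> int" where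
  "coords v = [(19,17,16), (-19,-17,16), (-30,6,-10), (30,-6,-10), (0,-7,7), (0,7,7), (40,40,27),
     (-40,-40,27), (-7,9,8), (7,-9,8)] ! v"

lemma immersed_facets: "immersed coords [0..<10] facets"
  unfolding facets_def coords_def by code_simp

section \<open>The half-turn\<close>

definition half_turn :: "real^3 \<Rightarrow> real^3" where
  "half_turn x = vector [- x $ 1, - x $ 2, x $ 3]"

lemma half_turn_half_turn: "half_turn (half_turn x) = x"
  by (simp add: half_turn_def vec_eq_iff forall_3)

lemma half_turn_sum: "half_turn (\<Sum>i\<in>I. x i *\<^sub>R f i) = (\<Sum>i\<in>I. x i *\<^sub>R half_turn (f i))"
  by (simp add: half_turn_def vec_eq_iff forall_3 sum_negf)

lemma dist_half_turn: "dist (half_turn x) (half_turn y) = dist x y"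
proof -
  have "dist (- r) (- s) = dist r s" for r s :: real by (simp add: dist_real_def)
  then show ?thesis by (simp add: half_turn_def dist_vec_def L2_set_def sum_3)
qed

lemma rotation_about_line_half_turn:
  "rotation_about_line (affine hull {0, axis 3 1}) half_turn"
  unfolding rotation_about_line_def
proof (intro conjI ballI)
  have "axis 3 1 \<noteq> (0 :: real^3)" by (simp add: axis_eq_0_iff)
  then show "aff_dim (affine hull {0, axis 3 1 :: real^3}) = 1"
    by (simp add: aff_dim_2)
  show "half_turn p = p" if "p \<in> affine hull {0, axis 3 1}" for p
    using that by (auto simp: affine_hull_2 half_turn_def vec_eq_iff forall_3 axis_def)
  define A :: "real^3^3" where "A = vector [vector [- 1, 0, 0], vector [0, - 1, 0], vector [0, 0, 1]]"
  have "orthogonal_matrix A"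
    by (simp add: orthogonal_matrix A_def transpose_def matrix_matrix_mult_def mat_def vec_eq_iff forall_3 sum_3)
  moreover have "det A = 1" by (simp add: det_3 A_def)
  moreover have "half_turn = (\<lambda>p. A *v p + 0)"
    by (rule ext) (simp add: A_def half_turn_def matrix_vector_mult_def vec_eq_iff forall_3 sum_3)
  ultimately show "\<exists>A b. rotation_matrix A \<and> half_turn = (\<lambda>p. A *v p + b)"
    unfolding rotation_matrix_def by blast
qed simp

text \<open>Because \<alpha> is its own inverse, pushing barycentric coordinates forward along it
  amounts to precomposing with it. Equivariance on vertices then extends by linearity, and
  invariance of the image follows from one inclusion, the half-turn being an involution too.\<close>

lemma geometric_symmetry_involution:
  fixes K :: "'v set set" and \<alpha> :: "'v \<Rightarrow> 'v"
  assumes K: "finite_simplicial_complex K"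
    and inv: "\<And>v. \<alpha> (\<alpha> v) = v" and pres: "\<And>\<sigma>. \<sigma> \<in> K \<Longrightarrow> \<alpha> ` \<sigma> \<in> K"
    and equi: "\<And>v. v \<in> vertices K \<Longrightarrow> half_turn (\<psi> v) = \<psi> (\<alpha> v)"
  shows "geometric_symmetry K \<psi> \<alpha> half_turn"
proof -
  let ?V = "vertices K" and ?X = "underlying_space K" and ?\<phi> = "simplexwise_linear_map K \<psi>"
  have inv_img: "\<alpha> ` \<alpha> ` \<sigma> = \<sigma>" for \<sigma> by (simp add: image_comp inv comp_def)
  have V: "\<alpha> v \<in> ?V" if "v \<in> ?V" for v using that pres by blast
  have bij: "bij_betw \<alpha> ?V ?V" by (rule bij_betw_byWitness[where f' = \<alpha>]) (use inv V in auto)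
  have auto: "simplicial_automorphism K \<alpha>"
    unfolding simplicial_automorphism_def
  proof
    show "(`) \<alpha> ` K = K"
    proof (intro equalityI subsetI)
      fix \<sigma> assume "\<sigma> \<in> K"
      then show "\<sigma> \<in> (`) \<alpha> ` K" using pres inv_img by (intro image_eqI[of _ _ "\<alpha> ` \<sigma>"]) simp_all
    qed (use pres in auto)
  qed (rule bij)
  have ind: "induced_map K \<alpha> x = (\<lambda>w. x (\<alpha> w))" if "x \<in> ?X" for x
  proof
    fix w
    have "{v \<in> ?V. \<alpha> v = w} = (if \<alpha> w \<in> ?V then {\<alpha> w} else {})"
      using inv by (auto split: if_splits)
    moreover have "x (\<alpha> w) = 0" if "\<alpha> w \<notin> ?V"
    proof -
      have "supp x \<subseteq> ?V" using \<open>x \<in> ?X\<close> by (auto simp: underlying_space_iff[OF K])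
      then show ?thesis using that by blast
    qed
    ultimately show "induced_map K \<alpha> x w = x (\<alpha> w)" by (simp add: induced_map_def)
  qed
  have ind_in: "induced_map K \<alpha> x \<in> ?X" if "x \<in> ?X" for x
  proof -
    have x: "\<And>v. 0 \<le> x v" "supp x \<in> K" "sum x (supp x) = 1"
      using that by (auto simp: underlying_space_iff[OF K])
    have s: "supp (\<lambda>w. x (\<alpha> w)) = \<alpha> ` supp x"
      using inv by (auto simp: image_iff) metis
    have "inj_on \<alpha> (supp x)" by (rule inj_on_inverseI[of _ \<alpha>]) (rule inv)
    then have "sum (\<lambda>w. x (\<alpha> w)) (\<alpha> ` supp x) = 1" by (simp add: sum.reindex inv x(3))
    then show ?thesis
      unfolding ind[OF that] using x pres[OF x(2)] by (simp add: underlying_space_iff[OF K] s)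
  qed
  have comm: "half_turn (?\<phi> x) = ?\<phi> (induced_map K \<alpha> x)" if "x \<in> ?X" for x
  proof -
    have "?\<phi> (induced_map K \<alpha> x) = (\<Sum>w\<in>?V. x (\<alpha> w) *\<^sub>R \<psi> w)"
      unfolding simplexwise_linear_map_def ind[OF that] ..
    also have "\<dots> = (\<Sum>v\<in>?V. x (\<alpha> (\<alpha> v)) *\<^sub>R \<psi> (\<alpha> v))"
      by (rule sum.reindex_bij_betw[OF bij, symmetric])
    also have "\<dots> = (\<Sum>v\<in>?V. x v *\<^sub>R half_turn (\<psi> v))"
      by (intro sum.cong) (simp_all add: inv equi)
    also have "\<dots> = half_turn (?\<phi> x)" by (simp only: half_turn_sum simplexwise_linear_map_def)
    finally show ?thesis by simp
  qed
  have sub: "half_turn ` ?\<phi> ` ?X \<subseteq> ?\<phi> ` ?X" using comm ind_in by auto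
  have "?\<phi> ` ?X \<subseteq> half_turn ` ?\<phi> ` ?X"
  proof
    fix y assume "y \<in> ?\<phi> ` ?X"
    then show "y \<in> half_turn ` ?\<phi> ` ?X"
      using sub by (intro image_eqI[of _ _ "half_turn y"]) (auto simp: half_turn_half_turn)
  qed
  with sub show ?thesis
    unfolding geometric_symmetry_def using dist_half_turn auto comm by blast
qed

text \<open>Truncated subtraction is harmless, as it is applied to odd numbers only; the map is an
  involution on all natural numbers, as \<open>geometric_symmetry_involution\<close>
  requires.\<close>

definition flip_pair :: "nat \<Rightarrow> nat" where
  "flip_pair v = (if even v then v + 1 else v - 1)"

lemma flip_pair_flip_pair: "flip_pair (flip_pair v) = v"
  by (auto simp: flip_pair_def elim: oddE)

lemma vertices_facets: "vertices (complex_of facets) = {0..<10}"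
proof -
  have "vertices (complex_of facets) = (\<Union>T\<in>set facets. set T)"
    by (auto simp: complex_of_def)
  also have "\<dots> = set [0..<10]" unfolding facets_def by code_simp
  finally show ?thesis by simp
qed

lemma flip_pair_facets: "\<forall>T\<in>set facets. \<exists>T'\<in>set facets. set (map flip_pair T) = set T'"
  unfolding facets_def flip_pair_def by code_simp

lemma half_turn_coords:
  assumes "v < 10"
  shows "half_turn (realize coords v) = realize coords (flip_pair v)"
proof -
  have "\<forall>v\<in>set [0..<10]. coords (flip_pair v) = (case coords v of (x, y, z) \<Rightarrow> (- x, - y, z))"
    unfolding coords_def flip_pair_def by code_simp
  then show ?thesis
    using assms by (auto simp: half_turn_def realize_def vec_eq_iff forall_3 split: prod.splits)
qed

lemma two_fold_rotational_symmetry_facets: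
  "two_fold_rotational_symmetry (complex_of facets) (realize coords)"
proof -
  have "flip_pair ` \<sigma> \<in> complex_of facets" if "\<sigma> \<in> complex_of facets" for \<sigma>
  proof -
    obtain T where T: "T \<in> set facets" "\<sigma> \<subseteq> set T" "\<sigma> \<noteq> {}" using \<open>\<sigma> \<in> complex_of facets\<close> by (auto simp: complex_of_def)
    then obtain T' where "T' \<in> set facets" "set (map flip_pair T) = set T'" using flip_pair_facets by blast
    moreover from this have "flip_pair ` \<sigma> \<subseteq> set T'" using T(2) by auto
    ultimately show ?thesis using T(3) unfolding complex_of_def by blast
  qed
  then have "geometric_symmetry (complex_of facets) (realize coords) flip_pair half_turn"
    by (intro geometric_symmetry_involution finite_simplicial_complex_complex_of flip_pair_flip_pair)
      (auto simp: vertices_facets half_turn_coords)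
  moreover have "half_turn (axis 1 1) \<noteq> axis 1 1" by (simp add: half_turn_def vec_eq_iff forall_3 axis_def)
  then have "half_turn \<noteq> id" by auto
  moreover have "half_turn \<circ> half_turn = id" by (simp add: fun_eq_iff half_turn_half_turn)
  moreover have "0 \<in> vertices (complex_of facets)" "flip_pair 0 \<noteq> 0"
    by (simp_all add: vertices_facets flip_pair_def)
  ultimately show ?thesis
    unfolding two_fold_rotational_symmetry_def using rotation_about_line_half_turn by blast
qed

lemma two_dimensional_facets: "two_dimensional (complex_of facets)"
proof -
  have len: "\<forall>T\<in>set facets. length T = 3" unfolding facets_def by code_simp
  have "card \<sigma> \<le> 3" if "\<sigma> \<in> complex_of facets" for \<sigma>
  proof -
    obtain T where "T \<in> set facets" "\<sigma> \<subseteq> set T" using \<open>\<sigma> \<in> complex_of facets\<close> by (auto simp: complex_of_def)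
    then show ?thesis using len card_mono[of "set T" \<sigma>] card_length[of T] by force
  qed
  moreover have "set [6, 1, 9] \<in> complex_of facets" unfolding complex_of_def facets_def by auto
  ultimately show ?thesis unfolding two_dimensional_def by (intro conjI ballI bexI[of _ "set [6, 1, 9]"]) auto
qed

theorem theorem5p7:
  shows "\<exists>(N :: (nat \<Rightarrow> real) topology) (\<Delta> :: nat set set) (\<psi> :: nat \<Rightarrow> real^3).
           nonorientable_surface 6 N \<and>
           triangulation_of \<Delta> N \<and> card (vertices \<Delta>) = 10 \<and>
           polyhedral_realization \<Delta> \<psi> \<and>
           two_fold_rotational_symmetry \<Delta> \<psi>"
proof (intro exI conjI)
  let ?\<Delta> = "complex_of facets"
  \<comment> \<open>Points of a complex on natural numbers are functions from \<open>nat\<close> to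
    \<open>real\<close>, so the underlying space itself is taken as the surface and the required
    homeomorphism is the identity.\<close>
  show "nonorientable_surface 6 (top_of_set (underlying_space ?\<Delta>))"
    by (rule nonorientable_surface_facets)
  show "triangulation_of ?\<Delta> (top_of_set (underlying_space ?\<Delta>))"
    unfolding triangulation_of_def
    using finite_simplicial_complex_complex_of two_dimensional_facets homeomorphic_space_refl by blast
  show "card (vertices ?\<Delta>) = 10" by (simp add: vertices_facets)
  show "polyhedral_realization ?\<Delta> (realize coords)"
    by (rule polyhedral_realization_if_immersed[OF immersed_facets])
  show "two_fold_rotational_symmetry ?\<Delta> (realize coords)"
    by (rule two_fold_rotational_symmetry_facets)
qed

end
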